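(* Let $\alpha\in(0,1)$ be irrational, $d\ge1$, $\psi(x)=\{x\}-\frac12$ and $S_\beta(x)=x+\beta$ on $\mathbb T$. The set of $(\beta_1,\dots,\beta_d)\in\mathbb T^d$ such that the cocycle $(\psi,\psi\circ S_{\beta_1},\dots,\psi\circ S_{\beta_d}):\mathbb T\to\mathbb R^{d+1}$ is ergodic over the rotation $Tx=x+\alpha$ is residual in $\mathbb T^d$ (i.e. it includes a dense $G_\delta$ subset).
   Context: $\mathbb T=[0,1)$ is the additive circle (addition mod $1$) with Lebesgue measure $\mu$; $\{x\}$ is the fractional part. A cocycle $\Phi:\mathbb T\to\mathbb R^m$ (a measurable function) is ergodic over $T$ if the skew product $T_\Phi(x,g)=(Tx,g+\Phi(x))$ is ergodic on $\mathbb T\times\mathbb R^m$ for the product of $\mu$ and Lebesgue measure on $\mathbb R^m$. *)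

theory Defs
  imports "HOL-Probability.Probability"
begin

definition circle_measure :: "real measure" where
  "circle_measure = restrict_space lborel {0..<1}"

text \<open>The quotient topology of the circle on its fundamental domain \<open>[0,1)\<close>, along \<open>frac\<close>.
  It is not the subspace topology of \<open>[0,1)\<close> in the reals.\<close>
definition circle_topology :: "real topology" where
  "circle_topology = topology (\<lambda>U. U \<subseteq> {0..<1} \<and> open (frac -` U))"

definition circle_rotation :: "real \<Rightarrow> real \<Rightarrow> real" where
  "circle_rotation \<alpha> x = frac (x + \<alpha>)"

abbreviation torus_topology :: "('d \<Rightarrow> real) topology" where
  "torus_topology \<equiv> product_topology (\<lambda>_. circle_topology) UNIV"

definition residual_in :: "'a topology \<Rightarrow> 'a set \<Rightarrow> bool" where
  "residual_in X S \<longleftrightarrow>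
     S \<subseteq> topspace X \<and> (\<exists>G. gdelta_in X G \<and> X closure_of G = topspace X \<and> G \<subseteq> S)"

text \<open>The measure may be infinite, so the alternative for an invariant set is null or co-null.\<close>
definition ergodic_map :: "'a measure \<Rightarrow> ('a \<Rightarrow> 'a) \<Rightarrow> bool" where
  "ergodic_map M T \<longleftrightarrow>
     T \<in> measurable M M \<and> distr M M T = M \<and>
     (\<forall>A\<in>sets M. T -` A \<inter> space M = A \<longrightarrow> emeasure M A = 0 \<or> emeasure M (space M - A) = 0)"

definition skew_product :: "('a \<Rightarrow> 'a) \<Rightarrow> ('a \<Rightarrow> 'g::plus) \<Rightarrow> 'a \<times> 'g \<Rightarrow> 'a \<times> 'g" where
  "skew_product T \<Phi> = (\<lambda>(x, g). (T x, g + \<Phi> x))"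

definition ergodic_cocycle ::
  "'a measure \<Rightarrow> ('a \<Rightarrow> 'a) \<Rightarrow> ('a \<Rightarrow> 'g::euclidean_space) \<Rightarrow> bool" where
  "ergodic_cocycle M T \<Phi> \<longleftrightarrow>
     \<Phi> \<in> borel_measurable M \<and> ergodic_map (M \<Otimes>\<^sub>M lborel) (skew_product T \<Phi>)"

definition psi :: "real \<Rightarrow> real" where
  "psi x = frac x - 1 / 2"

text \<open>With \<open>d = CARD('d)\<close>, the \<open>d + 1\<close> coordinates are indexed by \<open>'d option\<close>: \<open>None\<close> is the
  unshifted coordinate, \<open>Some i\<close> the one shifted by \<open>\<beta> i\<close>.\<close>
definition psi_cocycle :: "('d::finite \<Rightarrow> real) \<Rightarrow> real \<Rightarrow> real ^ 'd option" where
  "psi_cocycle \<beta> x =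
     (\<chi> j. case j of None \<Rightarrow> psi x | Some i \<Rightarrow> (psi \<circ> circle_rotation (\<beta> i)) x)"

lemma openin_circle_topology:
  "openin circle_topology U \<longleftrightarrow> U \<subseteq> {0..<1} \<and> open (frac -` U)"
proof -
  have "istopology (\<lambda>U::real set. U \<subseteq> {0..<1} \<and> open (frac -` U))"
    unfolding istopology_def by (auto simp: vimage_Int vimage_Union)
  then show ?thesis
    by (simp add: circle_topology_def topology_inverse')
qed

lemma topspace_circle_topology [simp]: "topspace circle_topology = {0..<1}"
proof
  show "topspace circle_topology \<subseteq> {0..<1}"
    by (auto simp: topspace_def openin_circle_topology)
  have "frac -` {0..<1} = (UNIV :: real set)"
    by (auto simp: frac_lt_1)
  then have "openin circle_topology {0..<1}"
    by (simp add: openin_circle_topology)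
  then show "{0..<1} \<subseteq> topspace circle_topology"
    by (rule openin_subset)
qed

lemma quotient_map_frac: "quotient_map euclidean circle_topology (frac :: real \<Rightarrow> real)"
proof -
  have "x \<in> range frac" if "0 \<le> x" "x < 1" for x :: real
    using that by (intro image_eqI[of _ _ x]) (auto simp: frac_eq)
  then have "range frac = {0..<1::real}"
    by (auto simp: frac_lt_1)
  then show ?thesis
    by (auto simp: quotient_map_def openin_circle_topology vimage_def)
qed

end

theory Submission
  imports Defs "HOL-Analysis.Kronecker_Approximation_Theorem"
begin

text \<open>
  Let \<open>q\<close> run through denominators with \<open>\<bar>q \<alpha> - p\<bar> < 1 / q\<close>. By Baire, generically the points \<open>q \<beta>\<close>
  are dense modulo 1, and this already implies ergodicity. For a set \<open>A\<close> invariant under the skew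
  product, the measure \<open>F x g\<close> of the part of the fibre of \<open>A\<close> over \<open>x\<close> in the window \<open>g + Q\<close> is
  uniformly continuous in \<open>g\<close> and satisfies \<open>F (x + \<alpha>) (g + \<Phi> x) = F x g\<close>. The Birkhoff sums
  \<open>S x\<close> of length \<open>q\<close> are bounded (Denjoy--Koksma), and \<open>q \<alpha>\<close> is close to 0 modulo 1, so
  \<open>F x (S x)\<close> is close to \<open>F x 0\<close> in mean. As \<open>S\<close> is almost invariant under the rotation, \<open>x\<close> and
  \<open>S x\<close> decouple: \<open>F y (S x)\<close> is close to \<open>F y 0\<close> in mean over \<open>x\<close> and \<open>y\<close>. Hence limits of typical
  values of \<open>S\<close> are periods of \<open>A\<close>. Modulo the integer lattice \<open>S x\<close> is
  \<open>(t, t + q \<beta>\<^sub>1, \<dots>, t + q \<beta>\<^sub>d)\<close> with \<open>t\<close> uniform, so every vector is a period up to one of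
  finitely many lattice vectors. The group of periods then has finite index in a divisible group, so
  it is everything, and ergodicity of the rotation finishes the proof.
\<close>

section \<open>Translations of Lebesgue measure\<close>

text \<open>Windows of fibres are bounded substitutes for an invariant set, and their modulus of
  continuity depends on the window alone, not on the fibre; this absorbs every small error in the
  group coordinate. The Birkhoff sums are explicit only modulo 1: their integer parts are floor
  counts that are never computed. Periods are therefore found only up to lattice vectors, and the
  Denjoy--Koksma bound is used a second time to leave finitely many of them. All estimates are
  approximate, yet exact periods come out. The mean effect of translating by \<open>S n x\<close>
  tends to 0, while a proportion of points bounded below has \<open>S n x\<close> near the target;
  compactness of a ball then gives a limit vector whose effect is exactly 0. The sequence
  \<open>q\<close> depends on \<alpha> only. The generic condition on \<beta> asks that one index
  serve all coordinates at the same time, which is what makes the coordinates of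
  \<open>S n x\<close> independent enough to approach an arbitrary vector modulo the
  lattice.\<close>

lemma borel_measurable_frac [measurable]: "(frac :: real \<Rightarrow> real) \<in> borel_measurable borel"
  unfolding frac_def[abs_def] by measurable

lemma AE_lborel_translate:
  fixes h :: "'a::euclidean_space"
  assumes [measurable]: "Measurable.pred borel P" and "AE x in lborel. P x"
  shows "AE x in lborel. P (h + x)"
  using assms(2) by (subst (asm) lborel_distr_plus[of h, symmetric]) (simp add: AE_distr_iff)

lemma integral_lborel_translate:
  fixes f :: "'a::euclidean_space \<Rightarrow> real"
  assumes [measurable]: "f \<in> borel_measurable borel"
  shows "(\<integral>x. f (h + x) \<partial>lborel) = (\<integral>x. f x \<partial>lborel)"
  by (subst (2) lborel_distr_plus[of h, symmetric], subst integral_distr) simp_all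

lemma integrable_lborel_translate:
  fixes f :: "'a::euclidean_space \<Rightarrow> real"
  assumes "integrable lborel f"
  shows "integrable lborel (\<lambda>x. f (h + x))"
proof -
  have [measurable]: "f \<in> borel_measurable borel"
    using assms by auto
  show ?thesis
    using assms by (subst (asm) lborel_distr_plus[of h, symmetric]) (simp add: integrable_distr_eq)
qed

text \<open>Outer regularity replaces \<open>A\<close> by an open \<open>U\<close>: a point of
  \<open>A\<close> stays in \<open>U\<close> under small translations, and \<open>U - A\<close> has
  small measure wherever it is moved.\<close>

lemma LIMSEQ_L1_translation_indicator:
  fixes A :: "'a::euclidean_space set"
  assumes A [measurable]: "A \<in> sets borel" and fin: "emeasure lborel A < \<infinity>" and X: "X \<longlonglongrightarrow> 0"
  shows "(\<lambda>n. \<integral>x. \<bar>indicator A (X n + x) - indicator A x :: real\<bar> \<partial>lborel) \<longlonglongrightarrow> 0"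
proof (rule LIMSEQ_I)
  fix r :: real assume "0 < r"
  then obtain U where U: "open U" "A \<subseteq> U" "emeasure lborel (U - A) < ennreal (r / 4)"
    using outer_regular_lborel[OF A, of "r / 4"] by auto
  have [measurable]: "U \<in> sets borel"
    using U by auto
  have iA: "integrable lborel (indicator A :: 'a \<Rightarrow> real)"
    using fin by (simp add: integrable_indicator_iff)
  have iU: "integrable lborel (indicator (U - A) :: 'a \<Rightarrow> real)"
    using U(3) by (simp add: integrable_indicator_iff order_less_trans[OF U(3)])
  have mU: "(\<integral>x. indicator (U - A) x \<partial>lborel) < r / 4"
  proof -
    have "measure lborel (U - A) < r / 4"
      unfolding measure_def using U(3) \<open>0 < r\<close> by (subst enn2real_less_iff) (auto intro: order_less_trans[OF U(3)])
    then show ?thesis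
      by simp
  qed
  define p where "p n x = (indicator A x * (1 - indicator U (X n + x)) :: real)" for n x
  have p_int: "integrable lborel (p n)" for n
    unfolding p_def by (rule Bochner_Integration.integrable_bound[OF iA]) (auto simp: indicator_def)
  have "(\<lambda>n. \<integral>x. p n x \<partial>lborel) \<longlonglongrightarrow> (\<integral>x. 0 \<partial>(lborel :: 'a measure))"
  proof (rule integral_dominated_convergence[where w = "indicator A"])
    show "AE x in lborel. (\<lambda>n. p n x) \<longlonglongrightarrow> 0"
    proof (intro AE_I2)
      fix x :: 'a
      show "(\<lambda>n. p n x) \<longlonglongrightarrow> 0"
      proof (cases "x \<in> A")
        case True
        have "(\<lambda>n. X n + x) \<longlonglongrightarrow> x"
          using tendsto_add[OF X tendsto_const[of x]] by simp
        then have "\<forall>\<^sub>F n in sequentially. X n + x \<in> U"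
          using U True by (intro topological_tendstoD) auto
        then have "\<forall>\<^sub>F n in sequentially. p n x = 0"
          by eventually_elim (simp add: p_def)
        then show ?thesis
          by (rule tendsto_eventually)
      qed (simp add: p_def)
    qed
    show "AE x in lborel. norm (p n x) \<le> indicator A x" for n
      by (auto simp: p_def indicator_def)
  qed (use iA in \<open>auto simp: p_def\<close>)
  then have "(\<lambda>n. \<integral>x. p n x \<partial>lborel) \<longlonglongrightarrow> 0"
    by simp
  then have "\<forall>\<^sub>F n in sequentially. (\<integral>x. p n x \<partial>lborel) < r / 4"
    using \<open>0 < r\<close> by (intro order_tendstoD(2)) auto
  then obtain N where N: "(\<integral>x. p n x \<partial>lborel) < r / 4" if "n \<ge> N" for n
    by (auto simp: eventually_sequentially)
  show "\<exists>no. \<forall>n\<ge>no. norm ((\<integral>x. \<bar>indicator A (X n + x) - indicator A x :: real\<bar> \<partial>lborel) - 0) < r"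
  proof (intro exI allI impI)
    fix n assume n: "n \<ge> N"
    let ?iA' = "\<lambda>x. indicator A (X n + x) :: real"
    let ?iU' = "\<lambda>x. indicator (U - A) (X n + x) :: real"
    have i1: "integrable lborel ?iA'" "integrable lborel ?iU'"
      by (rule integrable_lborel_translate[OF iA]) (rule integrable_lborel_translate[OF iU])
    \<comment> \<open>With \<open>a\<close> and \<open>b\<close> the translated and the original
      indicator, \<open>\<bar>a - b\<bar>\<close> is twice the positive part of \<open>b - a\<close>
      plus \<open>a - b\<close>. A point leaving \<open>A\<close> either leaves \<open>U\<close>
      (counted by \<open>p\<close>) or lands in \<open>U - A\<close>, and \<open>a - b\<close> has
      integral 0.\<close>
    have "(\<integral>x. \<bar>?iA' x - indicator A x\<bar> \<partial>lborel)
        \<le> (\<integral>x. 2 * (p n x + ?iU' x) + (?iA' x - indicator A x) \<partial>lborel)"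
    proof (rule integral_mono)
      show "\<bar>?iA' x - indicator A x\<bar> \<le> 2 * (p n x + ?iU' x) + (?iA' x - indicator A x)" for x
        by (auto simp: p_def indicator_def)
    qed (use i1 iA p_int in auto)
    also have "\<dots> = 2 * ((\<integral>x. p n x \<partial>lborel) + (\<integral>x. ?iU' x \<partial>lborel))
        + ((\<integral>x. ?iA' x \<partial>lborel) - (\<integral>x. indicator A x \<partial>lborel))"
      using i1 iA p_int by simp
    also have "(\<integral>x. ?iA' x \<partial>lborel) = (\<integral>x. indicator A x \<partial>lborel)"
      by (intro integral_lborel_translate) simp
    also have "(\<integral>x. ?iU' x \<partial>lborel) = (\<integral>x. indicator (U - A) x \<partial>lborel)"
      by (intro integral_lborel_translate) simp
    also have "2 * ((\<integral>x. p n x \<partial>lborel) + (\<integral>x. indicator (U - A) x \<partial>lborel))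
        + ((\<integral>x. indicator A x \<partial>lborel) - (\<integral>x. indicator A x \<partial>lborel)) < r"
      using N[OF n] mU by simp
    finally show "norm ((\<integral>x. \<bar>?iA' x - indicator A x\<bar> \<partial>lborel) - 0) < r"
      by simp
  qed
qed

lemma LIMSEQ_L1_translation:
  fixes f :: "'a::euclidean_space \<Rightarrow> real"
  assumes "integrable lborel f" and X: "X \<longlonglongrightarrow> 0"
  shows "(\<lambda>n. \<integral>x. \<bar>f (X n + x) - f x\<bar> \<partial>lborel) \<longlonglongrightarrow> 0"
  using assms(1)
proof (induction rule: integrable_induct)
  case (base A c)
  have "(\<lambda>n. (\<integral>x. \<bar>indicator A (X n + x) - indicator A x :: real\<bar> \<partial>lborel) * \<bar>c\<bar>) \<longlonglongrightarrow> 0 * \<bar>c\<bar>"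
    using base X by (intro tendsto_intros LIMSEQ_L1_translation_indicator) auto
  moreover have "\<bar>indicator A (X n + x) *\<^sub>R c - indicator A x *\<^sub>R c\<bar>
     = \<bar>indicator A (X n + x) - indicator A x :: real\<bar> * \<bar>c\<bar>" for n x
    by (auto simp: indicator_def)
  ultimately show ?case
    by simp
next
  case (add f g)
  note i = add.hyps add.hyps[THEN integrable_lborel_translate]
  have "(\<lambda>n. (\<integral>x. \<bar>f (X n + x) - f x\<bar> \<partial>lborel) + (\<integral>x. \<bar>g (X n + x) - g x\<bar> \<partial>lborel)) \<longlonglongrightarrow> 0"
    using tendsto_add[OF add.IH] by simp
  then show ?case
  proof (rule real_tendsto_sandwich[OF _ _ tendsto_const, rotated 2])
    have "(\<integral>x. \<bar>f (X n + x) + g (X n + x) - (f x + g x)\<bar> \<partial>lborel)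
        \<le> (\<integral>x. \<bar>f (X n + x) - f x\<bar> + \<bar>g (X n + x) - g x\<bar> \<partial>lborel)" for n
      using i by (intro integral_mono) auto
    then show "\<forall>\<^sub>F n in sequentially. (\<integral>x. \<bar>f (X n + x) + g (X n + x) - (f x + g x)\<bar> \<partial>lborel)
        \<le> (\<integral>x. \<bar>f (X n + x) - f x\<bar> \<partial>lborel) + (\<integral>x. \<bar>g (X n + x) - g x\<bar> \<partial>lborel)"
      using i by simp
  qed simp
next
  case (lim f s)
  have [measurable]: "f \<in> borel_measurable borel" "\<And>i. s i \<in> borel_measurable borel"
    using lim.hyps(1,4) by auto
  show ?case
  proof (rule LIMSEQ_I)
    fix r :: real assume "0 < r"
    have "(\<lambda>i. \<integral>x. \<bar>s i x - f x\<bar> \<partial>lborel) \<longlonglongrightarrow> (\<integral>x. 0 \<partial>(lborel :: 'a measure))"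
    \<comment> \<open>The simple functions satisfy
      \<open>\<bar>s i x\<bar> \<le> 2 * \<bar>f x\<bar>\<close>, hence the factor 3.\<close>
    proof (rule integral_dominated_convergence[where w = "\<lambda>x. 3 * \<bar>f x\<bar>"])
      show "AE x in lborel. (\<lambda>i. \<bar>s i x - f x\<bar>) \<longlonglongrightarrow> 0"
        using lim.hyps(2) by (intro AE_I2 tendsto_rabs_zero) (simp add: LIM_zero)
      show "AE x in lborel. norm \<bar>s i x - f x\<bar> \<le> 3 * \<bar>f x\<bar>" for i
      proof (intro AE_I2)
        fix x show "norm \<bar>s i x - f x\<bar> \<le> 3 * \<bar>f x\<bar>"
          using lim.hyps(3)[of x i] by simp
      qed
    qed (use lim.hyps(4) in auto)
    then have "(\<lambda>i. \<integral>x. \<bar>s i x - f x\<bar> \<partial>lborel) \<longlonglongrightarrow> 0"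
      by simp
    then have "\<forall>\<^sub>F i in sequentially. (\<integral>x. \<bar>s i x - f x\<bar> \<partial>lborel) < r / 3"
      using \<open>0 < r\<close> by (intro order_tendstoD(2)) auto
    then obtain i where i: "(\<integral>x. \<bar>s i x - f x\<bar> \<partial>lborel) < r / 3"
      by (auto simp: eventually_sequentially)
    have "\<forall>\<^sub>F n in sequentially. (\<integral>x. \<bar>s i (X n + x) - s i x\<bar> \<partial>lborel) < r / 3"
      using \<open>0 < r\<close> lim.IH[of i] by (intro order_tendstoD(2)) auto
    then obtain N where N: "(\<integral>x. \<bar>s i (X n + x) - s i x\<bar> \<partial>lborel) < r / 3" if "n \<ge> N" for n
      by (auto simp: eventually_sequentially)
    show "\<exists>no. \<forall>n\<ge>no. norm ((\<integral>x. \<bar>f (X n + x) - f x\<bar> \<partial>lborel) - 0) < r"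
    proof (intro exI allI impI)
      fix n assume n: "n \<ge> N"
      note ii = lim.hyps(1)[of i] lim.hyps(4) lim.hyps(1)[of i, THEN integrable_lborel_translate]
        lim.hyps(4)[THEN integrable_lborel_translate]
      have "(\<integral>x. \<bar>f (X n + x) - f x\<bar> \<partial>lborel)
          \<le> (\<integral>x. \<bar>s i (X n + x) - f (X n + x)\<bar> + \<bar>s i (X n + x) - s i x\<bar> + \<bar>s i x - f x\<bar> \<partial>lborel)"
        using ii by (intro integral_mono) auto
      also have "\<dots> = (\<integral>x. \<bar>s i (X n + x) - f (X n + x)\<bar> \<partial>lborel)
          + (\<integral>x. \<bar>s i (X n + x) - s i x\<bar> \<partial>lborel) + (\<integral>x. \<bar>s i x - f x\<bar> \<partial>lborel)"
        using ii by simp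
      also have "(\<integral>x. \<bar>s i (X n + x) - f (X n + x)\<bar> \<partial>lborel) = (\<integral>x. \<bar>s i x - f x\<bar> \<partial>lborel)"
        by (rule integral_lborel_translate) simp
      finally show "norm ((\<integral>x. \<bar>f (X n + x) - f x\<bar> \<partial>lborel) - 0) < r"
        using i N[OF n] by simp
    qed
  qed
qed

lemma L1_translation_small:
  fixes f :: "'a::euclidean_space \<Rightarrow> real"
  assumes f: "integrable lborel f" and "e > 0"
  obtains d where "d > 0" "\<And>t. norm t < d \<Longrightarrow> (\<integral>x. \<bar>f (t + x) - f x\<bar> \<partial>lborel) < e"
proof -
  have "((\<lambda>t. \<integral>x. \<bar>f (t + x) - f x\<bar> \<partial>lborel) \<longlongrightarrow> 0) (at 0)"
    unfolding tendsto_at_iff_sequentially o_def using LIMSEQ_L1_translation[OF f] by blast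
  then have "\<forall>\<^sub>F t in at 0. (\<integral>x. \<bar>f (t + x) - f x\<bar> \<partial>lborel) < e"
    using \<open>e > 0\<close> by (rule order_tendstoD(2))
  then obtain d where d: "d > 0" "\<And>t. t \<noteq> 0 \<Longrightarrow> dist t 0 < d \<Longrightarrow> (\<integral>x. \<bar>f (t + x) - f x\<bar> \<partial>lborel) < e"
    unfolding eventually_at by auto
  show thesis
  proof
    show "(\<integral>x. \<bar>f (t + x) - f x\<bar> \<partial>lborel) < e" if "norm t < d" for t
      using that d(2)[of t] \<open>e > 0\<close> by (cases "t = 0") auto
  qed fact
qed

section \<open>Rational boxes as a countable determining class\<close>

definition rat_boxes :: "'a::euclidean_space set set" where
  "rat_boxes = {box a b | a b. \<forall>i\<in>Basis. a \<bullet> i \<in> \<rat> \<and> b \<bullet> i \<in> \<rat>}"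

lemma countable_rat_boxes: "countable (rat_boxes :: 'a::euclidean_space set set)"
proof -
  let ?R = "{a :: 'a. \<forall>i\<in>Basis. a \<bullet> i \<in> \<rat>}"
  have "?R \<subseteq> (\<lambda>f. \<Sum>i\<in>Basis. f i *\<^sub>R i) ` (Basis \<rightarrow>\<^sub>E \<rat>)"
  proof
    fix a assume "a \<in> ?R"
    then show "a \<in> (\<lambda>f. \<Sum>i\<in>Basis. f i *\<^sub>R i) ` (Basis \<rightarrow>\<^sub>E \<rat>)"
      by (intro image_eqI[of _ _ "restrict (\<lambda>i. a \<bullet> i) Basis"]) (auto simp: euclidean_representation)
  qed
  then have "countable ?R"
    by (rule countable_subset) (intro countable_image countable_PiE finite_Basis countable_rat)
  then have "countable ((\<lambda>(a, b). box a b) ` (?R \<times> ?R))"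
    by auto
  then show ?thesis
    by (rule countable_subset[rotated]) (auto simp: rat_boxes_def)
qed

lemma borel_eq_rat_boxes: "borel = sigma UNIV (rat_boxes :: 'a::euclidean_space set set)"
proof (rule borel_eq_sigmaI1[OF borel_def, where F = id, simplified])
  fix M :: "'a set" assume "open M"
  let ?f = "\<lambda>f. \<Sum>i\<in>Basis. fst (f i) *\<^sub>R i :: 'a"
  let ?g = "\<lambda>f. \<Sum>i\<in>Basis. snd (f i) *\<^sub>R i :: 'a"
  have "(\<Union>f\<in>{f \<in> Basis \<rightarrow>\<^sub>E \<rat> \<times> \<rat>. box (?f f) (?g f) \<subseteq> M}. box (?f f) (?g f)) \<in> sigma_sets UNIV rat_boxes"
  proof (rule sigma_sets_UNION)
    show "countable ((\<lambda>f. box (?f f) (?g f)) ` {f \<in> Basis \<rightarrow>\<^sub>E \<rat> \<times> \<rat>. box (?f f) (?g f) \<subseteq> M})"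
      by (intro countable_image countable_Collect countable_PiE) (auto intro: countable_rat)
    fix B assume "B \<in> (\<lambda>f. box (?f f) (?g f)) ` {f \<in> Basis \<rightarrow>\<^sub>E \<rat> \<times> \<rat>. box (?f f) (?g f) \<subseteq> M}"
    then show "B \<in> sigma_sets UNIV rat_boxes"
      by (force simp: rat_boxes_def PiE_iff mem_Times_iff intro!: sigma_sets.Basic exI)
  qed
  then show "M \<in> sigma_sets UNIV rat_boxes"
    by (subst open_UNION_box[OF \<open>open M\<close>])
next
  show "i \<in> sets borel" if "i \<in> rat_boxes" for i :: "'a set"
    using that by (auto simp: rat_boxes_def)
qed

lemma rat_boxes_borel [measurable_dest]: "Q \<in> rat_boxes \<Longrightarrow> Q \<in> sets borel"
  by (auto simp: rat_boxes_def)

lemma emeasure_rat_boxes: "Q \<in> rat_boxes \<Longrightarrow> emeasure lborel Q < \<infinity>"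
  using emeasure_lborel_box_finite by (auto simp: rat_boxes_def)

lemma measure_eqI_rat_boxes:
  fixes M N :: "'a::euclidean_space measure"
  assumes sets: "sets M = sets borel" "sets N = sets borel"
    and eq: "\<And>Q. Q \<in> rat_boxes \<Longrightarrow> emeasure M Q = emeasure N Q"
    and fin: "\<And>Q. Q \<in> rat_boxes \<Longrightarrow> emeasure M Q \<noteq> \<infinity>"
  shows "M = N"
proof (rule measure_eqI_generator_eq)
  show "Int_stable (rat_boxes :: 'a set set)"
    unfolding Int_stable_def rat_boxes_def by (fastforce simp: box_Int_box max_def min_def)
  let ?A = "\<lambda>n::nat. box (- (real n *\<^sub>R One)) (real n *\<^sub>R One) :: 'a set"
  show "range ?A \<subseteq> rat_boxes"
    by (force simp: rat_boxes_def inner_simps)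
  then show "emeasure M (?A i) \<noteq> \<infinity>" for i
    using fin by blast
  show "(\<Union>i. ?A i) = UNIV"
    by (rule UN_box_eq_UNIV)
  show "sets M = sigma_sets UNIV rat_boxes" "sets N = sigma_sets UNIV rat_boxes"
    using sets by (simp_all add: borel_eq_rat_boxes)
qed (use eq in auto)

text \<open>The two indicators, taken as densities, define measures that agree on an
  intersection-stable generator and are finite there, so the measures coincide and the densities
  agree almost everywhere.\<close>

lemma AE_translate_iff_rat_boxes:
  fixes E :: "'a::euclidean_space set"
  assumes [measurable]: "E \<in> sets borel"
    and eq: "\<And>Q. Q \<in> rat_boxes \<Longrightarrow> emeasure lborel {s\<in>Q. s + h \<in> E} = emeasure lborel {s\<in>Q. s \<in> E}"
  shows "AE s in lborel. s + h \<in> E \<longleftrightarrow> s \<in> E"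
proof -
  let ?E = "{s. s + h \<in> E}"
  have [measurable]: "?E \<in> sets borel"
    by measurable
  have em: "emeasure (density lborel (indicator B)) Q = emeasure lborel {s\<in>Q. s \<in> B}"
    if "Q \<in> rat_boxes" and [measurable]: "B \<in> sets borel" for Q B :: "'a set"
  proof -
    have [measurable]: "Q \<in> sets borel"
      using that by (simp add: rat_boxes_borel)
    show ?thesis
      by (subst emeasure_density)
        (auto simp: nn_integral_indicator[symmetric] indicator_def intro!: nn_integral_cong simp del: nn_integral_indicator)
  qed
  have "density lborel (indicator ?E) = density lborel (indicator E)"
  proof (rule measure_eqI_rat_boxes)
    show "emeasure (density lborel (indicator ?E)) Q = emeasure (density lborel (indicator E)) Q"
      if "Q \<in> rat_boxes" for Q
      using that eq[OF that] by (simp add: em)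
    show "emeasure (density lborel (indicator ?E)) Q \<noteq> \<infinity>" if "Q \<in> rat_boxes" for Q
    proof -
      have "emeasure lborel {s \<in> Q. s \<in> ?E} \<le> emeasure lborel Q"
        using that by (intro emeasure_mono) (auto simp: rat_boxes_borel)
      then show ?thesis
        using that emeasure_rat_boxes[OF that] by (simp add: em top.not_eq_extremum)
    qed
  qed auto
  then have "AE s in lborel. indicator ?E s = (indicator E s :: ennreal)"
    by (subst (asm) sigma_finite_measure.density_unique_iff[OF sigma_finite_lborel]) auto
  then show ?thesis
    by eventually_elim (auto simp: indicator_def split: if_splits)
qed

section \<open>Translation invariance and the circle\<close>

text \<open>The null set in the hypothesis depends on \<open>h\<close>. Fubini exchanges the
  quantifiers: for almost every \<open>z\<close> the condition holds for almost every
  \<open>h\<close>, and after a translation by \<open>- snd z\<close> membership of \<open>z\<close>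
  equals that of almost every point in its fibre. One such point decides the whole fibre.\<close>

lemma AE_null_or_conull_if_translation_invariant:
  fixes A :: "('a \<times> 'g::euclidean_space) set"
  assumes M: "sigma_finite_measure M" and A [measurable]: "A \<in> sets (M \<Otimes>\<^sub>M borel)"
    and inv: "\<And>h. AE z in M \<Otimes>\<^sub>M lborel. (fst z, snd z + h) \<in> A \<longleftrightarrow> z \<in> A"
  shows "AE y in M. (AE s in lborel. (y, s) \<in> A) \<or> (AE s in lborel. (y, s) \<notin> A)"
proof -
  interpret M: sigma_finite_measure M by fact
  interpret P: pair_sigma_finite M "lborel :: 'g measure" ..
  interpret P2: sigma_finite_measure "M \<Otimes>\<^sub>M (lborel :: 'g measure)" ..
  interpret PP: pair_sigma_finite "lborel :: 'g measure" "M \<Otimes>\<^sub>M (lborel :: 'g measure)" ..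
  have [measurable_cong]: "sets (M \<Otimes>\<^sub>M (lborel :: 'g measure)) = sets (M \<Otimes>\<^sub>M borel)"
    by (rule sets_pair_measure_cong) auto
  have m1 [measurable]: "Measurable.pred (M \<Otimes>\<^sub>M borel) (\<lambda>z. z \<in> A)"
    using A by measurable
  have "AE h in lborel. AE z in M \<Otimes>\<^sub>M lborel. (fst z, snd z + h) \<in> A \<longleftrightarrow> z \<in> A"
    using inv by simp
  then have "AE z in M \<Otimes>\<^sub>M lborel. AE h in lborel. (fst z, snd z + h) \<in> A \<longleftrightarrow> z \<in> A"
    by (subst PP.AE_commute[symmetric]) measurable
  note step = this
  have "AE z in M \<Otimes>\<^sub>M lborel. AE h in lborel. (fst z, h) \<in> A \<longleftrightarrow> z \<in> A"
  proof (rule AE_mp[OF step], rule AE_I2, rule impI)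
    fix z assume z: "z \<in> space (M \<Otimes>\<^sub>M (lborel :: 'g measure))"
      and ae: "AE h in lborel. (fst z, snd z + h) \<in> A \<longleftrightarrow> z \<in> A"
    have [measurable]: "fst z \<in> space M"
      using z by (auto simp: space_pair_measure)
    show "AE h in lborel. (fst z, h) \<in> A \<longleftrightarrow> z \<in> A"
      using AE_lborel_translate[OF _ ae, of "- snd z"] by simp
  qed
  then have "AE y in M. AE s in lborel. AE h in lborel. (y, h) \<in> A \<longleftrightarrow> (y, s) \<in> A"
    by (auto dest: P.AE_pair)
  then show ?thesis
  proof eventually_elim
    case (elim y)
    have "ae_filter (lborel :: 'g measure) \<noteq> bot"
      by (simp add: ae_filter_eq_bot_iff)
    then obtain s where "AE h in lborel. (y, h) \<in> A \<longleftrightarrow> (y, s) \<in> A"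
      using eventually_happens'[OF _ elim] by blast
    then show ?case
      by (cases "(y, s) \<in> A") auto
  qed
qed

section \<open>The circle as a probability space with invariant measure\<close>

lemma space_circle_measure [simp]: "space circle_measure = {0..<1}"
  by (simp add: circle_measure_def space_restrict_space)

lemma sets_circle_measure: "A \<in> sets circle_measure \<longleftrightarrow> A \<in> sets borel \<and> A \<subseteq> {0..<1}"
  by (auto simp: circle_measure_def sets_restrict_space_iff)

lemma emeasure_circle_measure: "A \<subseteq> {0..<1} \<Longrightarrow> emeasure circle_measure A = emeasure lborel A"
  by (simp add: circle_measure_def emeasure_restrict_space)

lemma prob_space_circle_measure: "prob_space circle_measure"
  by (rule prob_spaceI) (simp add: emeasure_circle_measure)

interpretation circle: prob_space circle_measure
  by (rule prob_space_circle_measure)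

lemma measurable_id_circle [measurable]: "(\<lambda>x. x) \<in> circle_measure \<rightarrow>\<^sub>M borel"
  unfolding circle_measure_def by (intro measurable_restrict_space1) simp

lemma measurable_frac_circle [measurable]: "frac \<in> borel \<rightarrow>\<^sub>M circle_measure"
  unfolding circle_measure_def
  by (intro measurable_restrict_space2) (auto simp: frac_lt_1)

lemma measurable_circle_if_borel: "f \<in> borel \<rightarrow>\<^sub>M N \<Longrightarrow> f \<in> circle_measure \<rightarrow>\<^sub>M N"
  unfolding circle_measure_def by (intro measurable_restrict_space1) simp

lemma AE_circle_if_AE_lborel: "AE x in lborel. P x \<Longrightarrow> AE x in circle_measure. P x"
  unfolding circle_measure_def by (subst AE_restrict_space_iff) auto

lemma integral_circle:
  fixes f :: "real \<Rightarrow> real"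
  shows "(\<integral>x. f x \<partial>circle_measure) = (\<integral>x. indicator {0..<1} x * f x \<partial>lborel)"
  unfolding circle_measure_def by (subst integral_restrict_space) auto

lemma distr_circle_rotation: "distr circle_measure circle_measure (\<lambda>x. frac (x + t)) = circle_measure"
proof (rule measure_eqI)
  fix A assume "A \<in> sets (distr circle_measure circle_measure (\<lambda>x. frac (x + t)))"
  then have A': "A \<in> sets circle_measure"
    by simp
  then have A [measurable]: "A \<in> sets borel" and A01: "A \<subseteq> {0..<1}"
    by (simp_all add: sets_circle_measure)
  define s where "s = frac t"
  have s: "0 \<le> s" "s < 1"
    by (auto simp: s_def frac_lt_1)
  have ts: "frac (x + t) = frac (x + s)" for x
  proof -
    have "x + t = (x + s) + of_int \<lfloor>t\<rfloor>"
      by (simp add: s_def frac_def)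
    then show ?thesis
      by (simp only: frac_def floor_add_int) simp
  qed
  have ts': "frac (x + t) = (if x + s < 1 then x + s else x + s - 1)" if "0 \<le> x" "x < 1" for x
    unfolding ts using that s by (auto simp: frac_eq frac_unique_iff)
  \<comment> \<open>\<open>?B\<close> consists of the points that reach \<open>A\<close> without
    wrapping around, \<open>?C\<close> of those that wrap.\<close>
  let ?B = "(+) s -` (A \<inter> {s..<1})" and ?C = "(+) (s - 1) -` (A \<inter> {0..<s})"
  have eq: "(\<lambda>x. frac (x + t)) -` A \<inter> {0..<1} = ?B \<union> ?C"
    using A01 s by (auto simp: ts' subset_eq algebra_simps split: if_splits)
  have tr: "emeasure lborel ((+) c -` B) = emeasure lborel B" if [measurable]: "B \<in> sets borel" for B :: "real set" and c
    by (subst (2) lborel_distr_plus[of c, symmetric], subst emeasure_distr) auto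
  have "emeasure (distr circle_measure circle_measure (\<lambda>x. frac (x + t))) A
      = emeasure lborel (?B \<union> ?C)"
  proof -
    have "?B \<union> ?C \<subseteq> {0..<1}"
      using eq by auto
    then show ?thesis
      using A' eq by (subst emeasure_distr) (simp_all add: emeasure_circle_measure del: vimage_Int)
  qed
  also have "\<dots> = emeasure lborel ?B + emeasure lborel ?C"
    using s by (intro plus_emeasure[symmetric]) auto
  also have "\<dots> = emeasure lborel (A \<inter> {s..<1}) + emeasure lborel (A \<inter> {0..<s})"
    by (simp add: tr del: vimage_Int)
  also have "\<dots> = emeasure lborel ((A \<inter> {s..<1}) \<union> (A \<inter> {0..<s}))"
    by (intro plus_emeasure) auto
  also have "(A \<inter> {s..<1}) \<union> (A \<inter> {0..<s}) = A"
    using A01 s by auto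
  finally show "emeasure (distr circle_measure circle_measure (\<lambda>x. frac (x + t))) A = emeasure circle_measure A"
    using A01 by (simp add: emeasure_circle_measure)
qed simp

text \<open>Functions on the circle are handled as 1-periodic functions on the line, so that
  rotations become plain translations; this is the bridge between the two views.\<close>

lemma periodic_frac:
  fixes u :: "real \<Rightarrow> 'a"
  assumes "\<And>x. u (x + 1) = u x"
  shows "u (x + of_int k) = u x" "u (frac x) = u x"
proof -
  have n: "u (x + of_nat n) = u x" for n x
  proof (induction n)
    case (Suc n)
    have "u (x + of_nat (Suc n)) = u ((x + of_nat n) + 1)"
      by (simp add: algebra_simps)
    then show ?case
      using Suc assms by simp
  qed simp
  have *: "u (x + of_int k) = u x" for x k
  proof (cases k rule: int_cases2)
    case (nonneg m)
    then show ?thesis using n[of x m] by simp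
  next
    case (nonpos m)
    then show ?thesis using n[of "x - of_nat m" m] by simp
  qed
  show "u (x + of_int k) = u x" by (rule *)
  show "u (frac x) = u x"
    using *[of "frac x" "\<lfloor>x\<rfloor>"] by (simp add: frac_def)
qed

lemma integral_circle_rotate:
  fixes u :: "real \<Rightarrow> real"
  assumes [measurable]: "u \<in> borel_measurable borel" and "\<And>x. u (x + 1) = u x"
  shows "(\<integral>x. u (x + t) \<partial>circle_measure) = (\<integral>x. u x \<partial>circle_measure)"
proof -
  have [measurable]: "u \<in> borel_measurable circle_measure"
    by (intro measurable_circle_if_borel) simp
  have "(\<integral>x. u x \<partial>circle_measure) = (\<integral>x. u (frac (x + t)) \<partial>circle_measure)"
    by (subst (1) distr_circle_rotation[of t, symmetric], subst integral_distr) simp_all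
  then show ?thesis
    using periodic_frac(2)[of u] assms by simp
qed

lemma circle_integrable_bounded:
  fixes f :: "real \<Rightarrow> real"
  assumes "f \<in> borel_measurable borel" "\<And>x. \<bar>f x\<bar> \<le> B"
  shows "integrable circle_measure f"
  using assms by (intro circle.integrable_const_bound[where B = B] measurable_circle_if_borel) auto

lemma circle_translation_small:
  fixes u :: "real \<Rightarrow> real"
  assumes [measurable]: "u \<in> borel_measurable borel" and per: "\<And>x. u (x + 1) = u x"
    and B: "\<And>x. \<bar>u x\<bar> \<le> B" and "e > 0"
  obtains d where "d > 0" "\<And>t. \<bar>t\<bar> < d \<Longrightarrow> (\<integral>x. \<bar>u (x + t) - u x\<bar> \<partial>circle_measure) < e"
proof -
  \<comment> \<open>The interval contains \<open>x\<close> and \<open>x + t\<close> whenever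
    \<open>x\<close> is in [0,1) and \<open>\<bar>t\<bar> < 1\<close>, so the cutoff is invisible
    there and makes the function integrable on the line.\<close>
  define v where "v x = indicator {-1..2} x * u x" for x :: real
  have [measurable]: "v \<in> borel_measurable borel"
    unfolding v_def by measurable
  have v: "integrable lborel v"
  proof (rule Bochner_Integration.integrable_bound[where f = "\<lambda>x. B * indicator {-1..2} x"])
    show "AE x in lborel. norm (v x) \<le> norm (B * indicator {-1..2} x)"
      using B by (auto simp: v_def indicator_def abs_mult intro!: AE_I2 order_trans[OF B abs_ge_self])
  qed auto
  from L1_translation_small[OF this \<open>e > 0\<close>] obtain d where
    d: "d > 0" "\<And>t. norm t < d \<Longrightarrow> (\<integral>x. \<bar>v (t + x) - v x\<bar> \<partial>lborel) < e"
    by blast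
  show thesis
  proof
    show "(\<integral>x. \<bar>u (x + t) - u x\<bar> \<partial>circle_measure) < e" if t: "\<bar>t\<bar> < min d 1" for t
    proof -
      have "(\<integral>x. \<bar>u (x + t) - u x\<bar> \<partial>circle_measure)
          \<le> (\<integral>x. \<bar>v (t + x) - v x\<bar> \<partial>lborel)"
        unfolding integral_circle
      proof (rule integral_mono')
        show "integrable lborel (\<lambda>x. \<bar>v (t + x) - v x\<bar>)"
          using v integrable_lborel_translate[OF v] by auto
        show "indicator {0..<1} x * \<bar>u (x + t) - u x\<bar> \<le> \<bar>v (t + x) - v x\<bar>" for x
          using t by (auto simp: v_def indicator_def add.commute)
      qed auto
      also have "\<dots> < e"
        using t by (intro d) auto
      finally show ?thesis .
    qed
  qed (use d in auto)
qed

text \<open>This is the fibrewise dichotomy for a product set over the circle; since the circle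
  carries a probability measure, some base point satisfies it.\<close>

lemma null_or_conull_if_translation_invariant:
  fixes E :: "'g::euclidean_space set"
  assumes [measurable]: "E \<in> sets borel"
    and inv: "\<And>h. AE s in lborel. s + h \<in> E \<longleftrightarrow> s \<in> E"
  shows "(AE s in lborel. s \<in> E) \<or> (AE s in lborel. s \<notin> E)"
proof -
  let ?A = "{0..<1} \<times> E"
  have A: "?A \<in> sets (circle_measure \<Otimes>\<^sub>M borel)"
    by (intro pair_measureI) (auto simp: sets_circle_measure)
  interpret P: pair_sigma_finite circle_measure "lborel :: 'g measure" ..
  have "AE y in circle_measure. (AE s in lborel. (y, s) \<in> ?A) \<or> (AE s in lborel. (y, s) \<notin> ?A)"
  proof (rule AE_null_or_conull_if_translation_invariant[OF _ A])
    fix h :: 'g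
    have "AE y in circle_measure. AE s in lborel. s + h \<in> E \<longleftrightarrow> s \<in> E"
      using inv by simp
    then have "AE z in circle_measure \<Otimes>\<^sub>M lborel. snd z + h \<in> E \<longleftrightarrow> snd z \<in> E"
    proof (intro P.AE_pair_measure)
      have [measurable_cong]: "sets (circle_measure \<Otimes>\<^sub>M (lborel :: 'g measure)) = sets (circle_measure \<Otimes>\<^sub>M borel)"
        by (rule sets_pair_measure_cong) auto
      show "{x \<in> space (circle_measure \<Otimes>\<^sub>M lborel). (snd x + h \<in> E) = (snd x \<in> E)}
          \<in> sets (circle_measure \<Otimes>\<^sub>M lborel)"
        by measurable
    qed simp
    then show "AE z in circle_measure \<Otimes>\<^sub>M lborel. (fst z, snd z + h) \<in> ?A \<longleftrightarrow> z \<in> ?A"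
      by eventually_elim (auto simp: mem_Times_iff)
  qed unfold_locales
  with AE_space have "AE y in circle_measure. (AE s in lborel. s \<in> E) \<or> (AE s in lborel. s \<notin> E)"
    by eventually_elim auto
  then show ?thesis
    using eventually_happens'[OF circle.ae_filter_bot] by blast
qed

section \<open>Measures of windows and uniformly continuous functions on the cylinder\<close>

text \<open>The measure of \<open>E\<close> inside \<open>Q + h\<close>. It is finite for bounded
  \<open>Q\<close> even when \<open>E\<close> has infinite measure, and continuous in
  \<open>h\<close> although \<open>E\<close> is only measurable.\<close>

definition window :: "'g::euclidean_space set \<Rightarrow> 'g set \<Rightarrow> 'g \<Rightarrow> real" where
  "window Q E h = measure lborel {s\<in>Q. s + h \<in> E}"

lemma window_integral:
  fixes E Q :: "'g::euclidean_space set"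
  assumes [measurable]: "Q \<in> sets borel" "E \<in> sets borel"
  shows "window Q E h = (\<integral>s. indicator Q s * indicator E (s + h) \<partial>lborel)"
proof -
  have "{s\<in>Q. s + h \<in> E} \<in> sets lborel"
    by measurable
  then have "window Q E h = (\<integral>s. indicator {s\<in>Q. s + h \<in> E} s \<partial>lborel)"
    by (simp add: window_def)
  also have "\<dots> = (\<integral>s. indicator Q s * indicator E (s + h) \<partial>lborel)"
    by (intro Bochner_Integration.integral_cong) (auto simp: indicator_def)
  finally show ?thesis .
qed

lemma window_nonneg: "0 \<le> window Q E h"
  by (simp add: window_def)

lemma window_le:
  assumes [measurable]: "Q \<in> sets borel" "E \<in> sets borel" and "emeasure lborel Q < \<infinity>"
  shows "window Q E h \<le> measure lborel Q"
  unfolding window_def using assms by (intro measure_mono_fmeasurable) (auto simp: fmeasurable_def)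

text \<open>Moving the translation from \<open>E\<close> to \<open>Q\<close> bounds the difference
  by the L1 distance of two translates of the indicator of \<open>Q\<close>. Hence \<open>d\<close>
  does not depend on \<open>E\<close>, which later gives one modulus for all fibres of a
  set.\<close>

lemma window_uniformly_continuous:
  fixes Q :: "'g::euclidean_space set"
  assumes Q [measurable]: "Q \<in> sets borel" and fin: "emeasure lborel Q < \<infinity>" and "e > 0"
  obtains d where "d > 0"
    "\<And>E h k. E \<in> sets borel \<Longrightarrow> dist h k < d \<Longrightarrow> \<bar>window Q E h - window Q E k\<bar> < e"
proof -
  have iQ: "integrable lborel (indicator Q :: 'g \<Rightarrow> real)"
    using fin by (simp add: integrable_indicator_iff)
  obtain d where d: "d > 0"
    "\<And>t. norm t < d \<Longrightarrow> (\<integral>x. \<bar>indicator Q (t + x) - indicator Q x :: real\<bar> \<partial>lborel) < e"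
    using L1_translation_small[OF iQ \<open>e > 0\<close>] by blast
  show thesis
  proof (rule that[OF d(1)])
    fix E :: "'g set" and h k :: 'g
    assume [measurable]: "E \<in> sets borel" and "dist h k < d"
    have eq: "window Q E u = (\<integral>s. indicator Q (- u + s) * indicator E s \<partial>lborel)" for u
      unfolding window_integral[OF Q \<open>E \<in> sets borel\<close>]
      by (subst integral_lborel_translate[where h = u, symmetric]) (simp_all add: add.commute)
    have i: "integrable lborel (\<lambda>s. indicator Q (- u + s) * indicator E s :: real)" for u
      by (rule Bochner_Integration.integrable_bound[OF integrable_lborel_translate[OF iQ, of "- u"]])
        (auto simp: indicator_def)
    have i2: "integrable lborel (\<lambda>s. \<bar>indicator Q (- h + s) - indicator Q (- k + s) :: real\<bar>)"
      by (intro integrable_abs Bochner_Integration.integrable_diff integrable_lborel_translate iQ)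
    have "\<bar>window Q E h - window Q E k\<bar>
        = \<bar>\<integral>s. indicator Q (- h + s) * indicator E s - indicator Q (- k + s) * indicator E s \<partial>lborel\<bar>"
      unfolding eq using i by simp
    also have "\<dots> \<le> (\<integral>s. \<bar>indicator Q (- h + s) * indicator E s - indicator Q (- k + s) * indicator E s\<bar> \<partial>lborel)"
      by (rule integral_abs_bound)
    also have "\<dots> \<le> (\<integral>s. \<bar>indicator Q (- h + s) - indicator Q (- k + s)\<bar> \<partial>lborel)"
    proof (rule integral_mono)
      show "\<bar>indicator Q (- h + s) * indicator E s - indicator Q (- k + s) * indicator E s :: real\<bar>
          \<le> \<bar>indicator Q (- h + s) - indicator Q (- k + s)\<bar>" for s
        by (auto simp: indicator_def)
    qed (use i i2 in auto)
    also have "\<dots> = (\<integral>s. \<bar>indicator Q ((k - h) + s) - indicator Q s\<bar> \<partial>lborel)"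
      by (subst integral_lborel_translate[where h = k, symmetric]) (simp_all add: algebra_simps)
    also have "\<dots> < e"
      using \<open>dist h k < d\<close> by (intro d(2)) (simp add: dist_norm norm_minus_commute)
    finally show "\<bar>window Q E h - window Q E k\<bar> < e" .
  qed
qed

lemma AE_translate_iff_window:
  fixes E :: "'a::euclidean_space set"
  assumes [measurable]: "E \<in> sets borel"
    and eq: "\<And>Q. Q \<in> rat_boxes \<Longrightarrow> window Q E h = window Q E 0"
  shows "AE s in lborel. s + h \<in> E \<longleftrightarrow> s \<in> E"
proof (rule AE_translate_iff_rat_boxes)
  fix Q :: "'a set" assume Q: "Q \<in> rat_boxes"
  have fin: "emeasure lborel {s\<in>Q. s + u \<in> E} < \<infinity>" for u
    using Q by (intro order_le_less_trans[OF emeasure_mono emeasure_rat_boxes[OF Q]])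
      (auto simp: rat_boxes_borel)
  show "emeasure lborel {s\<in>Q. s + h \<in> E} = emeasure lborel {s\<in>Q. s \<in> E}"
    using eq[OF Q] fin[of h] fin[of 0]
    by (simp add: window_def emeasure_eq_ennreal_measure top.not_eq_extremum)
qed simp

text \<open>A window of the lifted set takes the same value at 0 and at every
  \<open>of_int k * \<alpha> - of_int m\<close> with \<open>k > 0\<close>. These points are dense
  and the window is continuous, so every real number is a period.\<close>

lemma circle_rotation_ergodic:
  assumes \<alpha>: "\<alpha> \<notin> \<rat>" and A: "A \<in> sets circle_measure"
    and inv: "\<And>x. x \<in> {0..<1} \<Longrightarrow> circle_rotation \<alpha> x \<in> A \<longleftrightarrow> x \<in> A"
  shows "(AE x in circle_measure. x \<in> A) \<or> (AE x in circle_measure. x \<notin> A)"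
proof -
  have [measurable]: "A \<in> sets borel"
    using A by (simp add: sets_circle_measure)
  define E where "E = frac -` A"
  have E [measurable]: "E \<in> sets borel"
    unfolding E_def by (rule measurable_sets_borel[where M = borel]) simp_all
  have int: "x + of_int k \<in> E \<longleftrightarrow> x \<in> E" for x k
    by (simp add: E_def frac_def)
  have one: "x + \<alpha> \<in> E \<longleftrightarrow> x \<in> E" for x
  proof -
    have "x + \<alpha> \<in> E \<longleftrightarrow> frac x + \<alpha> \<in> E"
      using int[of "frac x + \<alpha>" "\<lfloor>x\<rfloor>"] by (simp add: frac_def)
    also have "\<dots> \<longleftrightarrow> frac x \<in> A"
      using inv[of "frac x"] by (simp add: E_def circle_rotation_def frac_lt_1)
    finally show ?thesis by (simp add: E_def)
  qed
  have nat: "x + of_nat n * \<alpha> \<in> E \<longleftrightarrow> x \<in> E" for x n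
  proof (induction n)
    case (Suc n)
    then show ?case using one[of "x + of_nat n * \<alpha>"] by (simp add: algebra_simps)
  qed simp
  have "AE s in lborel. s + h \<in> E \<longleftrightarrow> s \<in> E" for h
  proof (rule AE_translate_iff_window)
    fix Q :: "real set" assume Q: "Q \<in> rat_boxes"
    have "\<bar>window Q E h - window Q E 0\<bar> < e" if e: "e > 0" for e
    proof -
      obtain d where d: "d > 0" "\<And>u v. dist u v < d \<Longrightarrow> \<bar>window Q E u - window Q E v\<bar> < e"
        using window_uniformly_continuous[OF rat_boxes_borel[OF Q] emeasure_rat_boxes[OF Q] e] E
        by metis
      obtain m k where k: "k > 0" "\<bar>of_int k * \<alpha> - of_int m - h\<bar> < d"
        using sequence_of_fractional_parts_is_dense[OF \<alpha> d(1)] by blast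
      have "s + (of_int k * \<alpha> - of_int m) \<in> E \<longleftrightarrow> s \<in> E" for s
        using nat[of "s - of_int m" "nat k"] int[of s "- m"] k(1) by (simp add: algebra_simps)
      then have "window Q E (of_int k * \<alpha> - of_int m) = window Q E 0"
        by (simp add: window_def)
      then show ?thesis
        using d(2)[of h "of_int k * \<alpha> - of_int m"] k(2) by (simp add: dist_real_def abs_minus_commute)
    qed
    \<comment> \<open>A positive difference would be smaller than itself.\<close>
    from this[of "\<bar>window Q E h - window Q E 0\<bar>"] show "window Q E h = window Q E 0"
      by fastforce
  qed simp
  from null_or_conull_if_translation_invariant[OF E this]
  have "(AE x in circle_measure. x \<in> E) \<or> (AE x in circle_measure. x \<notin> E)"
    using AE_circle_if_AE_lborel by blast
  moreover have "AE x in circle_measure. x \<in> E \<longleftrightarrow> x \<in> A"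
    by (rule AE_I2) (simp add: E_def frac_eq_id)
  ultimately show ?thesis
    by (elim disjE) (rule disjI1, elim AE_mp, simp, rule disjI2, elim AE_mp, simp)
qed

text \<open>What a window of the fibre over \<open>x\<close>, placed at \<open>g\<close>, satisfies
  for every measurable set, invariant or not. In the last clause \<open>d\<close> is chosen before
  \<open>x\<close>: the modulus in \<open>g\<close> is uniform over the base.\<close>

definition admissible :: "(real \<Rightarrow> 'g::euclidean_space \<Rightarrow> real) \<Rightarrow> bool" where
  "admissible F \<longleftrightarrow> (\<lambda>(x, g). F x g) \<in> borel_measurable (borel \<Otimes>\<^sub>M borel)
     \<and> (\<forall>x g. F (x + 1) g = F x g) \<and> (\<exists>B. \<forall>x g. \<bar>F x g\<bar> \<le> B)
     \<and> (\<forall>e>0. \<exists>d>0. \<forall>x g h. dist g h < d \<longrightarrow> \<bar>F x g - F x h\<bar> < e)"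

lemma admissible_measurable [measurable_dest]:
  assumes "admissible F" and [measurable]: "f \<in> borel_measurable M" "g \<in> borel_measurable M"
  shows "(\<lambda>z. F (f z) (g z)) \<in> borel_measurable M"
proof -
  have [measurable]: "(\<lambda>(x, g). F x g) \<in> borel_measurable (borel \<Otimes>\<^sub>M borel)"
    using assms(1) by (simp add: admissible_def)
  have "(\<lambda>z. (\<lambda>(x, g). F x g) (f z, g z)) \<in> borel_measurable M"
    by measurable
  then show ?thesis by simp
qed

lemma admissible_shift:
  assumes "admissible F" shows "admissible (\<lambda>x. F (x + t))"
proof -
  have "(\<lambda>z. F (fst z + t) (snd z)) \<in> borel_measurable (borel \<Otimes>\<^sub>M borel)"
    by (rule admissible_measurable[OF assms]) measurable
  moreover have "F (x + 1 + t) g = F (x + t) g" for x g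
  proof -
    have "F ((x + t) + 1) g = F (x + t) g"
      using assms unfolding admissible_def by blast
    then show ?thesis
      by (simp add: algebra_simps)
  qed
  moreover have "\<exists>B. \<forall>x g. \<bar>F (x + t) g\<bar> \<le> B"
    using assms unfolding admissible_def by blast
  moreover have "\<forall>e>0. \<exists>d>0. \<forall>x g h. dist g h < d \<longrightarrow> \<bar>F (x + t) g - F (x + t) h\<bar> < e"
    using assms unfolding admissible_def by blast
  ultimately show ?thesis
    unfolding admissible_def by (simp add: case_prod_beta')
qed

lemma admissible_int: "admissible F \<Longrightarrow> F (x + of_int k) g = F x g"
  using periodic_frac(1)[of "\<lambda>x. F x g"] by (simp add: admissible_def)

text \<open>The bound must be uniform in \<open>v\<close>, because it is applied to
  \<open>S n\<close> with varying \<open>n\<close>. A finite net of the ball of radius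
  \<open>C\<close> reduces it to finitely many functions on the circle: replacing \<open>v x\<close>
  by a net point costs \<open>e / 4\<close> at each of the two arguments.\<close>

lemma admissible_translation_small:
  fixes F :: "real \<Rightarrow> 'g::euclidean_space \<Rightarrow> real"
  assumes F: "admissible F" and "e > 0"
  obtains d where "d > 0" "\<And>t v. \<bar>t\<bar> < d \<Longrightarrow> v \<in> borel_measurable borel \<Longrightarrow> (\<And>x. norm (v x) \<le> C)
    \<Longrightarrow> (\<integral>x. \<bar>F (x + t) (v x) - F x (v x)\<bar> \<partial>circle_measure) < e"
proof -
  note [measurable] = admissible_measurable[OF F]
  obtain B where B: "\<And>x g. \<bar>F x g\<bar> \<le> B"
    using F by (auto simp: admissible_def)
  obtain r where r: "r > 0" "\<And>x g h. dist g h < r \<Longrightarrow> \<bar>F x g - F x h\<bar> < e / 4"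
  proof -
    have "e / 4 > 0"
      using \<open>e > 0\<close> by simp
    then have "\<exists>r>0. \<forall>x g h. dist g h < r \<longrightarrow> \<bar>F x g - F x h\<bar> < e / 4"
      using F unfolding admissible_def by blast
    then show thesis
      using that by blast
  qed
  have "\<exists>k. finite k \<and> cball (0 :: 'g) C \<subseteq> (\<Union>x\<in>k. ball x r)"
    using compact_cball[of "0 :: 'g" C] r(1) by (simp only: compact_eq_totally_bounded)
  then obtain N where N: "finite N" "cball (0 :: 'g) C \<subseteq> (\<Union>w\<in>N. ball w r)"
    by (elim exE conjE)
  \<comment> \<open>Adding 1 keeps the denominator positive for an empty net and makes the sum over
    the net strictly less than \<open>e / 2\<close>.\<close>
  let ?e = "e / (2 * (card N + 1))"
  have "?e > 0"
    using \<open>e > 0\<close> by simp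
  have "\<exists>d>0. \<forall>t. \<bar>t\<bar> < d \<longrightarrow> (\<integral>x. \<bar>F (x + t) w - F x w\<bar> \<partial>circle_measure) < ?e" for w
  proof -
    have "(\<lambda>x. F x w) \<in> borel_measurable borel" "\<And>x. F (x + 1) w = F x w"
      using F by (measurable, simp add: admissible_def)
    from circle_translation_small[OF this B \<open>?e > 0\<close>] show ?thesis
      by metis
  qed
  then obtain d where d: "\<And>w. d w > 0"
      "\<And>w t. \<bar>t\<bar> < d w \<Longrightarrow> (\<integral>x. \<bar>F (x + t) w - F x w\<bar> \<partial>circle_measure) < ?e"
    by metis
  \<comment> \<open>The inserted 1 keeps the minimum defined when the net is empty.\<close>
  let ?d = "Min (insert 1 (d ` N))"
  show thesis
  proof
    show "?d > 0"
      using N(1) d(1) by (subst Min_gr_iff) auto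
    fix t :: real and v :: "real \<Rightarrow> 'g"
    assume t: "\<bar>t\<bar> < ?d" and [measurable]: "v \<in> borel_measurable borel" and C: "\<And>x. norm (v x) \<le> C"
    have t': "\<bar>t\<bar> < d w" if "w \<in> N" for w
      using t N(1) that by (subst (asm) Min_gr_iff) auto
    \<comment> \<open>The net point near \<open>v x\<close> varies with \<open>x\<close>, so all net
      points are summed; the right-hand side no longer mentions \<open>v\<close>.\<close>
    have pw: "\<bar>F (x + t) (v x) - F x (v x)\<bar> \<le> e / 2 + (\<Sum>w\<in>N. \<bar>F (x + t) w - F x w\<bar>)" for x
    proof -
      have "v x \<in> cball 0 C"
        using C[of x] by simp
      then obtain w where w: "w \<in> N" "dist w (v x) < r"
        using N(2) by (auto simp: subset_iff)
      have "\<bar>F (x + t) w - F x w\<bar> \<le> (\<Sum>w\<in>N. \<bar>F (x + t) w - F x w\<bar>)"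
        using N(1) w(1) by (intro member_le_sum) auto
      then show ?thesis
        using r(2)[OF w(2), of x] r(2)[OF w(2), of "x + t"] by linarith
    qed
    have "\<bar>F (x + t) w - F x w\<bar> \<le> 2 * B" for x w
      using B[of "x + t" w] B[of x w] by auto
    then have i: "integrable circle_measure (\<lambda>x. \<bar>F (x + t) w - F x w\<bar>)" for w
      by (intro circle_integrable_bounded[where B = "2 * B"]) auto
    have "(\<integral>x. \<bar>F (x + t) (v x) - F x (v x)\<bar> \<partial>circle_measure)
        \<le> (\<integral>x. e / 2 + (\<Sum>w\<in>N. \<bar>F (x + t) w - F x w\<bar>) \<partial>circle_measure)"
    proof (rule integral_mono')
      show "integrable circle_measure (\<lambda>x. e / 2 + (\<Sum>w\<in>N. \<bar>F (x + t) w - F x w\<bar>))"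
        using i by auto
    qed (use pw \<open>e > 0\<close> in \<open>auto intro!: add_nonneg_nonneg sum_nonneg\<close>)
    also have "\<dots> = e / 2 + (\<Sum>w\<in>N. \<integral>x. \<bar>F (x + t) w - F x w\<bar> \<partial>circle_measure)"
      using i circle.prob_space by simp
    also have "\<dots> \<le> e / 2 + (\<Sum>w\<in>N. ?e)"
      using d(2)[OF t'] by (intro add_left_mono sum_mono less_imp_le) auto
    also have "\<dots> < e"
      using \<open>e > 0\<close> by (simp add: field_simps)
    finally show "(\<integral>x. \<bar>F (x + t) (v x) - F x (v x)\<bar> \<partial>circle_measure) < e" .
  qed
qed

section \<open>Decoupling along rigidity times\<close>

text \<open>The discontinuities lie in finitely many translates of a countable set, which is
  null.\<close>

lemma AE_isCont_sum_translates:
  fixes \<Phi> :: "real \<Rightarrow> 'g::euclidean_space"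
  assumes "countable {x. \<not> isCont \<Phi> x}"
  shows "AE x in lborel. isCont (\<lambda>x. \<Sum>i<j. \<Phi> (x + real i * \<alpha>)) x"
proof -
  have "countable (\<Union>i<j. (\<lambda>x. x - real i * \<alpha>) ` {x. \<not> isCont \<Phi> x})"
    using assms by auto
  then have "AE x in lborel. x \<notin> (\<Union>i<j. (\<lambda>x. x - real i * \<alpha>) ` {x. \<not> isCont \<Phi> x})"
    by (intro AE_not_in countable_imp_null_set_lborel)
  then show ?thesis
  proof eventually_elim
    case (elim x)
    have "isCont (\<lambda>x. \<Phi> (x + real i * \<alpha>)) x" if "i < j" for i
    proof -
      have "isCont \<Phi> (x + real i * \<alpha>)"
      proof -
        have "\<forall>y. isCont \<Phi> y \<or> x \<noteq> y - real i * \<alpha>"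
          using elim that by auto
        from this[rule_format, of "x + real i * \<alpha>"] show ?thesis
          by simp
      qed
      then show ?thesis
        by (intro isCont_o2[where f = "\<lambda>x. x + real i * \<alpha>" and g = \<Phi>]) auto
    qed
    then show ?case
      by (intro continuous_intros) auto
  qed
qed

text \<open>Isolates what the decoupling needs from the cocycle: times \<open>q n\<close> at which
  the rotation is nearly the identity and the Birkhoff sums stay in a fixed ball. Nothing here is
  special to the sawtooth.\<close>

locale bounded_rigidity =
  fixes \<alpha> :: real and \<Phi> :: "real \<Rightarrow> 'g::euclidean_space" and q :: "nat \<Rightarrow> nat" and p :: "nat \<Rightarrow> int"
    and C :: real
  assumes irrational: "\<alpha> \<notin> \<rat>"
    and \<Phi>_measurable [measurable]: "\<Phi> \<in> borel_measurable borel"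
    and \<Phi>_periodic: "\<Phi> (x + 1) = \<Phi> x"
    and \<Phi>_cont: "countable {x. \<not> isCont \<Phi> x}"
    and rigid: "(\<lambda>n. real (q n) * \<alpha> - of_int (p n)) \<longlonglongrightarrow> 0"
    and sums_bounded: "norm (\<Sum>i<q n. \<Phi> (x + real i * \<alpha>)) \<le> C"
begin

definition birkhoff :: "nat \<Rightarrow> real \<Rightarrow> 'g" where
  "birkhoff k x = (\<Sum>i<k. \<Phi> (x + real i * \<alpha>))"

lemma birkhoff_measurable [measurable]: "birkhoff k \<in> borel_measurable borel"
  unfolding birkhoff_def by measurable

lemma birkhoff_add: "birkhoff (k + l) x = birkhoff k x + birkhoff l (x + real k * \<alpha>)"
proof -
  have "(\<Sum>i<k + l. \<Phi> (x + real i * \<alpha>)) = birkhoff k x + (\<Sum>i<l. \<Phi> (x + real (k + i) * \<alpha>))"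
    unfolding birkhoff_def by (induction l) (simp_all add: add.assoc)
  then show ?thesis
    by (simp add: birkhoff_def algebra_simps)
qed

lemma \<Phi>_int: "\<Phi> (x + of_int k) = \<Phi> x"
  using periodic_frac(1)[of \<Phi>] \<Phi>_periodic by blast

lemma birkhoff_int: "birkhoff k (x + of_int m) = birkhoff k x"
  unfolding birkhoff_def using \<Phi>_int[of "x + real i * \<alpha>" m for i]
  by (intro sum.cong) (simp_all add: algebra_simps)

definition \<delta> :: "nat \<Rightarrow> real" where "\<delta> n = real (q n) * \<alpha> - of_int (p n)"

lemma \<delta>_tendsto: "\<delta> \<longlonglongrightarrow> 0"
  using rigid by (simp add: \<delta>_def[abs_def])

definition S :: "nat \<Rightarrow> real \<Rightarrow> 'g" where "S n = birkhoff (q n)"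

lemma S_measurable [measurable]: "S n \<in> borel_measurable borel"
  unfolding S_def by measurable

lemma S_bounded: "norm (S n x) \<le> C"
  using sums_bounded by (simp add: S_def birkhoff_def)

text \<open>Splitting the Birkhoff sum of length \<open>j + q n\<close> in both orders trades a
  shift of the long sum along the orbit for a shift by the small \<open>\<delta> n\<close> of a sum
  of fixed length \<open>j\<close>.\<close>

lemma S_shift: "S n (x + real j * \<alpha>) - S n x = birkhoff j (x + \<delta> n) - birkhoff j x"
proof -
  have "birkhoff j x + S n (x + real j * \<alpha>) = S n x + birkhoff j (x + real (q n) * \<alpha>)"
    unfolding S_def birkhoff_add[symmetric] by (simp add: add.commute)
  moreover have "birkhoff j (x + real (q n) * \<alpha>) = birkhoff j (x + \<delta> n)"
    using birkhoff_int[of j "x + \<delta> n" "p n"] by (simp add: \<delta>_def)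
  ultimately show ?thesis
    by (simp add: algebra_simps)
qed

lemma S_shift_tendsto: "AE x in circle_measure. (\<lambda>n. S n (x + real j * \<alpha>) - S n x) \<longlonglongrightarrow> 0"
proof (rule AE_circle_if_AE_lborel)
  show "AE x in lborel. (\<lambda>n. S n (x + real j * \<alpha>) - S n x) \<longlonglongrightarrow> 0"
    using AE_isCont_sum_translates[OF \<Phi>_cont, of \<alpha> j]
  proof eventually_elim
    case (elim x)
    then have c: "isCont (birkhoff j) x"
      by (simp add: birkhoff_def[abs_def])
    have "(\<lambda>n. x + \<delta> n) \<longlonglongrightarrow> x + 0"
      by (intro tendsto_intros \<delta>_tendsto)
    then have "(\<lambda>n. birkhoff j (x + \<delta> n)) \<longlonglongrightarrow> birkhoff j x"
      by (intro isCont_tendsto_compose[OF c]) simp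
    then show ?case
      unfolding S_shift by (rule LIM_zero)
  qed
qed

definition invariant :: "(real \<Rightarrow> 'g \<Rightarrow> real) \<Rightarrow> bool" where
  "invariant F \<longleftrightarrow> (\<forall>x g. F (x + \<alpha>) (g + \<Phi> x) = F x g)"

lemma invariant_birkhoff:
  assumes "invariant F"
  shows "F (x + real k * \<alpha>) (g + birkhoff k x) = F x g"
proof (induction k)
  case (Suc k)
  have "F ((x + real k * \<alpha>) + \<alpha>) ((g + birkhoff k x) + \<Phi> (x + real k * \<alpha>)) = F x g"
    using assms Suc unfolding invariant_def by metis
  then show ?case
    by (simp add: birkhoff_def algebra_simps)
qed (simp add: birkhoff_def)

lemma invariant_S:
  assumes "invariant F" "admissible F"
  shows "F (x + \<delta> n) (S n x) = F x 0"
  using invariant_birkhoff[OF assms(1), of x "q n" 0] admissible_int[OF assms(2), of "x + \<delta> n" "p n"]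
  by (simp add: S_def \<delta>_def)

lemma admissible_bound:
  assumes "admissible F"
  obtains B where "\<And>x g y h. \<bar>F x g - F y h\<bar> \<le> B"
proof -
  obtain B where B: "\<And>x g. \<bar>F x g\<bar> \<le> B"
    using assms by (auto simp: admissible_def)
  show thesis
  proof (rule that[of "2 * B"])
    show "\<bar>F x g - F y h\<bar> \<le> 2 * B" for x g y h
      using B[of x g] B[of y h] by linarith
  qed
qed

text \<open>By invariance \<open>F x 0\<close> equals \<open>F (x + \<delta> n) (S n x)\<close>, so
  only the base point moves, by \<open>\<delta> n\<close>. The translation estimate applies to all
  \<open>S n\<close> at once because they share the bound \<open>C\<close>.\<close>

lemma tendsto_0_S:
  assumes F: "admissible F" and inv: "invariant F"
  shows "(\<lambda>n. \<integral>x. \<bar>F x (S n x) - F x 0\<bar> \<partial>circle_measure) \<longlonglongrightarrow> 0"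
proof (rule LIMSEQ_I)
  fix r :: real assume "0 < r"
  then obtain d where d: "d > 0" "\<And>t v. \<bar>t\<bar> < d \<Longrightarrow> v \<in> borel_measurable borel \<Longrightarrow> (\<And>x. norm (v x) \<le> C)
    \<Longrightarrow> (\<integral>x. \<bar>F (x + t) (v x) - F x (v x)\<bar> \<partial>circle_measure) < r"
    using admissible_translation_small[OF F, of r C] by blast
  obtain N where N: "\<bar>\<delta> n\<bar> < d" if "n \<ge> N" for n
    using LIMSEQ_D[OF \<delta>_tendsto d(1)] by auto
  have "(\<integral>x. \<bar>F x (S n x) - F x 0\<bar> \<partial>circle_measure) < r" if "n \<ge> N" for n
    using d(2)[OF N[OF that] S_measurable[of n] S_bounded]
    by (simp add: invariant_S[OF inv F] abs_minus_commute)
  then show "\<exists>no. \<forall>n\<ge>no. norm ((\<integral>x. \<bar>F x (S n x) - F x 0\<bar> \<partial>circle_measure) - 0) < r"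
    by (intro exI[of _ N]) auto
qed

text \<open>The first step of the decoupling: the base point moves along the orbit while the sum
  stays attached to \<open>x\<close>. Almost invariance allows \<open>S n x\<close> to be replaced
  by \<open>S n (x + real j * \<alpha>)\<close>, and a rotation of the integral reduces to the case
  \<open>j = 0\<close>.\<close>

lemma tendsto_0_S_orbit:
  assumes F: "admissible F" and inv: "invariant F"
  shows "(\<lambda>n. \<integral>x. \<bar>F (x + real j * \<alpha>) (S n x) - F (x + real j * \<alpha>) 0\<bar> \<partial>circle_measure) \<longlonglongrightarrow> 0"
proof -
  note [measurable] = admissible_measurable[OF F]
  obtain B where B: "\<And>x g y h. \<bar>F x g - F y h\<bar> \<le> B"
    using admissible_bound[OF F] by blast
  let ?a = "\<lambda>n x. \<bar>F (x + real j * \<alpha>) (S n x) - F (x + real j * \<alpha>) (S n (x + real j * \<alpha>))\<bar>"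
  let ?b = "\<lambda>n x. \<bar>F (x + real j * \<alpha>) (S n (x + real j * \<alpha>)) - F (x + real j * \<alpha>) 0\<bar>"
  have am: "?a n \<in> borel_measurable borel" and bm: "?b n \<in> borel_measurable borel" for n
    by measurable
  have i: "integrable circle_measure (?a n)" "integrable circle_measure (?b n)" for n
    using am bm B by (auto intro!: circle_integrable_bounded[where B = B])
  have "(\<lambda>n. \<integral>x. ?a n x \<partial>circle_measure) \<longlonglongrightarrow> (\<integral>x. 0 \<partial>circle_measure)"
  proof (rule integral_dominated_convergence[where w = "\<lambda>_. B"])
    show "AE x in circle_measure. (\<lambda>n. ?a n x) \<longlonglongrightarrow> 0"
      using S_shift_tendsto[of j]
    proof eventually_elim
      case (elim x)
      show ?case
      proof (rule LIMSEQ_I)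
        fix r :: real assume "0 < r"
        then obtain d where d: "d > 0" "\<And>x g h. dist g h < d \<Longrightarrow> \<bar>F x g - F x h\<bar> < r"
          using F unfolding admissible_def by meson
        obtain N where "norm (S n (x + real j * \<alpha>) - S n x) < d" if "n \<ge> N" for n
          using LIMSEQ_D[OF elim d(1)] by auto
        then show "\<exists>no. \<forall>n\<ge>no. norm (?a n x - 0) < r"
          by (intro exI[of _ N]) (auto intro!: d(2) simp: dist_norm norm_minus_commute)
      qed
    qed
    show "AE x in circle_measure. norm (?a n x) \<le> B" for n
      using B by auto
  qed (use am in \<open>auto intro!: measurable_circle_if_borel\<close>)
  then have a: "(\<lambda>n. \<integral>x. ?a n x \<partial>circle_measure) \<longlonglongrightarrow> 0"
    by simp
  have "(\<integral>x. ?b n x \<partial>circle_measure) = (\<integral>x. \<bar>F x (S n x) - F x 0\<bar> \<partial>circle_measure)" for n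
  proof (rule integral_circle_rotate)
    have "F (x + 1) g = F x g" for x g
      using F by (simp add: admissible_def)
    moreover have "S n (x + 1) = S n x" for x
      using birkhoff_int[of "q n" x 1] by (simp add: S_def)
    ultimately show "\<bar>F (x + 1) (S n (x + 1)) - F (x + 1) 0\<bar> = \<bar>F x (S n x) - F x 0\<bar>" for x
      by simp
  qed measurable
  then have b: "(\<lambda>n. \<integral>x. ?b n x \<partial>circle_measure) \<longlonglongrightarrow> 0"
    using tendsto_0_S[OF F inv] by simp
  from tendsto_add[OF a b] have ab: "(\<lambda>n. \<integral>x. ?a n x + ?b n x \<partial>circle_measure) \<longlonglongrightarrow> 0"
    using i by simp
  show ?thesis
  proof (rule real_tendsto_sandwich[OF _ _ tendsto_const ab])
    show "\<forall>\<^sub>F n in sequentially. (\<integral>x. \<bar>F (x + real j * \<alpha>) (S n x) - F (x + real j * \<alpha>) 0\<bar> \<partial>circle_measure)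
        \<le> (\<integral>x. ?a n x + ?b n x \<partial>circle_measure)"
      using i by (intro always_eventually allI integral_mono') auto
  qed simp
qed

text \<open>Orbit shifts are dense modulo 1, and replacing \<open>t\<close> by a nearby orbit shift
  costs an error that is uniform in \<open>n\<close>. The orbit time can therefore be fixed before
  \<open>n\<close> tends to infinity.\<close>

lemma tendsto_0_S_translate:
  assumes F: "admissible F" and inv: "invariant F"
  shows "(\<lambda>n. \<integral>x. \<bar>F (x + t) (S n x) - F (x + t) 0\<bar> \<partial>circle_measure) \<longlonglongrightarrow> 0"
proof (rule LIMSEQ_I)
  fix r :: real assume "0 < r"
  note [measurable] = admissible_measurable[OF F]
  obtain B where B: "\<And>x g y h. \<bar>F x g - F y h\<bar> \<le> B"
    using admissible_bound[OF F] by blast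
  have C: "0 \<le> C"
    using order_trans[OF norm_ge_zero S_bounded] .
  have "r / 3 > 0"
    using \<open>0 < r\<close> by simp
  then obtain d where d: "d > 0" "\<And>s v. \<bar>s\<bar> < d \<Longrightarrow> v \<in> borel_measurable borel \<Longrightarrow> (\<And>x. norm (v x) \<le> C)
    \<Longrightarrow> (\<integral>x. \<bar>F (x + s + t) (v x) - F (x + t) (v x)\<bar> \<partial>circle_measure) < r / 3"
    using admissible_translation_small[OF admissible_shift[OF F, of t], of "r / 3" C] by blast
  obtain m k where k: "k > 0" "\<bar>of_int k * \<alpha> - of_int m - t\<bar> < d"
    using sequence_of_fractional_parts_is_dense[OF irrational d(1)] by blast
  define s where "s = of_int k * \<alpha> - of_int m - t"
  have s: "\<bar>s\<bar> < d"
    using k by (simp add: s_def)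
  have Fs: "F (x + real (nat k) * \<alpha>) g = F (x + s + t) g" for x g
    using admissible_int[OF F, of "x + s + t" m g] k(1) by (simp add: s_def algebra_simps)
  obtain N where N: "(\<integral>x. \<bar>F (x + s + t) (S n x) - F (x + s + t) 0\<bar> \<partial>circle_measure) < r / 3"
    if "n \<ge> N" for n
    using LIMSEQ_D[OF tendsto_0_S_orbit[OF F inv, of "nat k"] \<open>r / 3 > 0\<close>] unfolding Fs by auto
  show "\<exists>no. \<forall>n\<ge>no. norm ((\<integral>x. \<bar>F (x + t) (S n x) - F (x + t) 0\<bar> \<partial>circle_measure) - 0) < r"
  proof (intro exI allI impI)
    fix n assume n: "n \<ge> N"
    let ?a = "\<lambda>x. \<bar>F (x + s + t) (S n x) - F (x + t) (S n x)\<bar>"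
    let ?b = "\<lambda>x. \<bar>F (x + s + t) (S n x) - F (x + s + t) 0\<bar>"
    let ?c = "\<lambda>x. \<bar>F (x + s + t) 0 - F (x + t) 0\<bar>"
    have m: "?a \<in> borel_measurable borel" "?b \<in> borel_measurable borel" "?c \<in> borel_measurable borel"
      by measurable
    have i: "integrable circle_measure ?a" "integrable circle_measure ?b" "integrable circle_measure ?c"
      using m B by (auto intro!: circle_integrable_bounded[where B = B])
    have "(\<integral>x. \<bar>F (x + t) (S n x) - F (x + t) 0\<bar> \<partial>circle_measure)
        \<le> (\<integral>x. ?a x + ?b x + ?c x \<partial>circle_measure)"
      using i by (intro integral_mono') auto
    also have "\<dots> = (\<integral>x. ?a x \<partial>circle_measure) + (\<integral>x. ?b x \<partial>circle_measure) + (\<integral>x. ?c x \<partial>circle_measure)"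
      using i by simp
    also have "\<dots> < r"
      using d(2)[OF s S_measurable[of n] S_bounded] N[OF n] d(2)[OF s, of "\<lambda>_. 0"] C by simp
    finally show "norm ((\<integral>x. \<bar>F (x + t) (S n x) - F (x + t) 0\<bar> \<partial>circle_measure) - 0) < r"
      by simp
  qed
qed

end

text \<open>The L1 distance between \<open>F\<close> at height \<open>h\<close> and at height 0. For
  windows of a set it measures how far \<open>h\<close> is from being a period.\<close>

definition discrepancy :: "(real \<Rightarrow> 'g::euclidean_space \<Rightarrow> real) \<Rightarrow> 'g \<Rightarrow> real" where
  "discrepancy F h = (\<integral>y. \<bar>F y h - F y 0\<bar> \<partial>circle_measure)"

lemma discrepancy_nonneg: "0 \<le> discrepancy F h"
  by (simp add: discrepancy_def)

lemma continuous_discrepancy: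
  assumes F: "admissible F"
  shows "continuous_on UNIV (discrepancy F)"
  unfolding continuous_on_iff
proof (intro ballI allI impI)
  fix g :: 'a and e :: real assume "e > 0"
  note [measurable] = admissible_measurable[OF F]
  have "e / 2 > 0" using \<open>e > 0\<close> by simp
  then obtain d where d: "d > 0" "\<And>x g h. dist g h < d \<Longrightarrow> \<bar>F x g - F x h\<bar> < e / 2"
    using F unfolding admissible_def by meson
  obtain B where B: "\<And>x g. \<bar>F x g\<bar> \<le> B"
    using F by (auto simp: admissible_def)
  have BB: "\<bar>F x g - F x 0\<bar> \<le> 2 * B" for x g
    using B[of x g] B[of x 0] by linarith
  have i: "integrable circle_measure (\<lambda>y. \<bar>F y h - F y 0\<bar>)" for h
    using BB by (intro circle_integrable_bounded[where B = "2 * B"]) auto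
  show "\<exists>d>0. \<forall>h\<in>UNIV. dist h g < d \<longrightarrow> dist (discrepancy F h) (discrepancy F g) < e"
  proof (intro exI conjI ballI impI, rule d(1))
    fix h assume "dist h g < d"
    have "\<bar>discrepancy F h - discrepancy F g\<bar>
        = \<bar>\<integral>y. \<bar>F y h - F y 0\<bar> - \<bar>F y g - F y 0\<bar> \<partial>circle_measure\<bar>"
      using i by (simp add: discrepancy_def)
    also have "\<dots> \<le> (\<integral>y. \<bar>\<bar>F y h - F y 0\<bar> - \<bar>F y g - F y 0\<bar>\<bar> \<partial>circle_measure)"
      by (rule integral_abs_bound)
    also have "\<dots> \<le> (\<integral>y. e / 2 \<partial>circle_measure)"
    proof (rule integral_mono')
      show "\<bar>\<bar>F y h - F y 0\<bar> - \<bar>F y g - F y 0\<bar>\<bar> \<le> e / 2" for y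
        using d(2)[OF \<open>dist h g < d\<close>, of y] by linarith
    qed (use \<open>e > 0\<close> in auto)
    also have "\<dots> = e / 2"
      using circle.prob_space by simp
    finally show "dist (discrepancy F h) (discrepancy F g) < e"
      using \<open>e > 0\<close> by (simp add: dist_real_def)
  qed
qed

lemma discrepancy_measurable:
  assumes "admissible F" shows "discrepancy F \<in> borel_measurable borel"
  by (rule borel_measurable_continuous_onI[OF continuous_discrepancy[OF assms]])

lemma discrepancy_eq_0D:
  assumes F: "admissible F" and "discrepancy F h = 0"
  shows "AE y in circle_measure. F y h = F y 0"
proof -
  note [measurable] = admissible_measurable[OF F]
  obtain B where B: "\<And>x g. \<bar>F x g\<bar> \<le> B"
    using F by (auto simp: admissible_def)
  have "\<bar>F x h - F x 0\<bar> \<le> 2 * B" for x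
    using B[of x h] B[of x 0] by linarith
  then have "integrable circle_measure (\<lambda>y. \<bar>F y h - F y 0\<bar>)"
    by (intro circle_integrable_bounded[where B = "2 * B"]) auto
  then show ?thesis
    using assms(2) unfolding discrepancy_def
    by (subst (asm) integral_nonneg_eq_0_iff_AE) auto
qed

context bounded_rigidity
begin

text \<open>Averaging the previous limit over all translates \<open>t\<close> completes the
  decoupling: after Fubini the inner integral over \<open>t\<close> forgets \<open>x\<close> by
  rotation invariance, and only the height \<open>S n x\<close> remains.\<close>

lemma discrepancy_S_tendsto_0:
  assumes F: "admissible F" and inv: "invariant F"
  shows "(\<lambda>n. \<integral>x. discrepancy F (S n x) \<partial>circle_measure) \<longlonglongrightarrow> 0"
proof -
  note [measurable] = admissible_measurable[OF F] measurable_circle_if_borel[OF S_measurable]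
  obtain B where B: "\<And>x g y h. \<bar>F x g - F y h\<bar> \<le> B"
    using admissible_bound[OF F] by blast
  interpret P: pair_prob_space circle_measure circle_measure ..
  let ?c = "\<lambda>n t. \<integral>x. \<bar>F (x + t) (S n x) - F (x + t) 0\<bar> \<partial>circle_measure"
  have eq: "(\<integral>x. discrepancy F (S n x) \<partial>circle_measure) = (\<integral>t. ?c n t \<partial>circle_measure)" for n
  proof -
    have "integrable (circle_measure \<Otimes>\<^sub>M circle_measure) (\<lambda>(x, t). \<bar>F (x + t) (S n x) - F (x + t) 0\<bar>)"
      using B by (intro P.P.integrable_const_bound[where B = B]) (auto simp: case_prod_beta')
    from P.Fubini_integral[OF this]
    have "(\<integral>t. ?c n t \<partial>circle_measure)
        = (\<integral>x. (\<integral>t. \<bar>F (x + t) (S n x) - F (x + t) 0\<bar> \<partial>circle_measure) \<partial>circle_measure)"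
      by simp
    also have "\<dots> = (\<integral>x. discrepancy F (S n x) \<partial>circle_measure)"
    proof (intro Bochner_Integration.integral_cong refl)
      fix x
      have "F (y + 1) g = F y g" for y g
        using F by (simp add: admissible_def)
      then show "(\<integral>t. \<bar>F (x + t) (S n x) - F (x + t) 0\<bar> \<partial>circle_measure) = discrepancy F (S n x)"
        unfolding discrepancy_def
        by (subst integral_circle_rotate[where t = x, symmetric]) (simp_all add: add.commute)
    qed
    finally show ?thesis by simp
  qed
  have "(\<lambda>n. \<integral>t. ?c n t \<partial>circle_measure) \<longlonglongrightarrow> (\<integral>t. 0 \<partial>circle_measure)"
  proof (rule integral_dominated_convergence[where w = "\<lambda>_. B"])
    show "?c n \<in> borel_measurable circle_measure" for n
      by measurable
    show "AE t in circle_measure. (\<lambda>n. ?c n t) \<longlonglongrightarrow> 0"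
      using tendsto_0_S_translate[OF F inv] by simp
    show "AE t in circle_measure. norm (?c n t) \<le> B" for n
    proof (rule AE_I2)
      fix t
      have "?c n t \<le> (\<integral>x. B \<partial>circle_measure)"
        \<comment> \<open>Comparing a value with itself gives \<open>0 \<le> B\<close>.\<close>
        using B[of 0 0 0 0] by (intro integral_mono' B) auto
      then show "norm (?c n t) \<le> B"
        using circle.prob_space by simp
    qed
  qed auto
  then show ?thesis
    by (simp add: eq)
qed

end

section \<open>Periods of invariant sets\<close>

text \<open>The group \<open>H\<close> has at most \<open>card K\<close> cosets meeting the unit
  ball, so two of the vectors \<open>v / 1, v / 2, ..., v / (L + 1)\<close> differ by an element of
  \<open>H\<close>. Clearing denominators puts \<open>(n - m) v\<close> into \<open>H\<close>, hence
  also \<open>L! v\<close>; as \<open>v\<close> is arbitrary in the unit ball, divisibility gives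
  everything.\<close>

lemma finite_index_subgroup_eq_UNIV:
  fixes H K :: "'g::real_normed_vector set"
  assumes diff: "\<And>x y. x \<in> H \<Longrightarrow> y \<in> H \<Longrightarrow> x - y \<in> H" and fin: "finite K"
    and cover: "\<And>v. norm v \<le> 1 \<Longrightarrow> \<exists>k\<in>K. v + k \<in> H"
  shows "H = UNIV"
proof -
  define L where "L = card K"
  have zero: "0 \<in> H"
    using cover[of 0] diff by force
  have add: "x + y \<in> H" if "x \<in> H" "y \<in> H" for x y
    using diff[OF that(1) diff[OF zero that(2)]] by simp
  have mult: "real n *\<^sub>R x \<in> H" if "x \<in> H" for n x
    using that zero add by (induction n) (auto simp: scaleR_left_distrib)
  have *: "fact L *\<^sub>R v \<in> H" if v: "norm v \<le> 1" for v
  proof -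
    have "\<exists>k\<in>K. (1 / real (Suc n)) *\<^sub>R v + k \<in> H" for n
    proof (rule cover)
      have "norm v \<le> real (Suc n)"
        using v by simp
      then show "norm ((1 / real (Suc n)) *\<^sub>R v) \<le> 1"
        by (simp add: divide_simps)
    qed
    then obtain k where k: "\<And>n. k n \<in> K" "\<And>n. (1 / real (Suc n)) *\<^sub>R v + k n \<in> H"
      by metis
    \<comment> \<open>The indices 0 to \<open>L\<close> are \<open>L + 1\<close> many, while at most
      \<open>L\<close> representatives are available.\<close>
    have "card (k ` {..L}) \<le> L"
      using k(1) fin unfolding L_def by (intro card_mono) auto
    then have "\<not> inj_on k {..L}"
      by (intro pigeonhole) simp
    then obtain m n where mn: "m < n" "n \<le> L" "k m = k n"
      unfolding inj_on_def by (metis atMost_iff linorder_neqE_nat)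
    have "(1 / real (Suc m)) *\<^sub>R v - (1 / real (Suc n)) *\<^sub>R v \<in> H"
      using diff[OF k(2)[of m] k(2)[of n]] mn(3) by simp
    then have "real (Suc m * Suc n) *\<^sub>R ((1 / real (Suc m)) *\<^sub>R v - (1 / real (Suc n)) *\<^sub>R v) \<in> H"
      by (rule mult)
    also have "real (Suc m * Suc n) *\<^sub>R ((1 / real (Suc m)) *\<^sub>R v - (1 / real (Suc n)) *\<^sub>R v) = real (n - m) *\<^sub>R v"
    proof -
      have "real (Suc m * Suc n) * (1 / real (Suc m) - 1 / real (Suc n)) = real (n - m)"
      proof -
        have "a * b * (1 / a - 1 / b) = b - a" if "a > 0" "b > 0" for a b :: real
          using that by (simp add: field_simps)
        then have "real (Suc m * Suc n) * (1 / real (Suc m) - 1 / real (Suc n)) = real (Suc n) - real (Suc m)"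
          unfolding of_nat_mult by (metis of_nat_0_less_iff zero_less_Suc)
        then show ?thesis
          using mn(1) by (simp only: of_nat_diff of_nat_Suc less_imp_le)
      qed
      then show ?thesis
        by (metis scaleR_left_diff_distrib scaleR_scaleR)
    qed
    finally have "real (n - m) *\<^sub>R v \<in> H" .
    moreover obtain c where "fact L = c * (n - m)"
    proof -
      have "n - m dvd fact L"
        using mn by (intro dvd_fact) auto
      then show thesis
        using that by (metis dvdE mult.commute)
    qed
    then have "(fact L :: real) = real c * real (n - m)"
      by (metis of_nat_fact of_nat_mult)
    ultimately show ?thesis
      using mult[of "real (n - m) *\<^sub>R v" c] by simp
  qed
  have "u \<in> H" for u
  proof -
    obtain r :: nat where r: "norm u < real r"
      using reals_Archimedean2 by blast
    then have r0: "real r > 0"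
      using norm_ge_zero[of u] by linarith
    \<comment> \<open>Dividing by \<open>fact L\<close> in advance cancels the factor in
      \<open>*\<close>; dividing by \<open>r\<close> reaches the unit ball.\<close>
    have "norm ((1 / (real r * fact L)) *\<^sub>R u) \<le> 1"
    proof -
      have "norm u \<le> real r * 1"
        using r by simp
      also have "\<dots> \<le> real r * fact L"
        by (intro mult_left_mono) (simp_all add: fact_ge_1)
      finally show ?thesis
        using r0 by (simp add: divide_simps)
    qed
    from mult[OF *[OF this], of r] show ?thesis
      using r0 by simp
  qed
  then show ?thesis by auto
qed

context bounded_rigidity
begin

lemma discrepancy_bounded:
  assumes F: "admissible F"
  obtains B where "\<And>h. \<bar>discrepancy F h\<bar> \<le> B"
proof -
  obtain B where B: "\<And>x g y h. \<bar>F x g - F y h\<bar> \<le> B"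
    using admissible_bound[OF F] by blast
  have "discrepancy F h \<le> (\<integral>y. B \<partial>circle_measure)" for h
    unfolding discrepancy_def using B[of 0 0 0 0] by (intro integral_mono' B) auto
  then have "\<bar>discrepancy F h\<bar> \<le> B" for h
    using circle.prob_space by (simp add: discrepancy_nonneg)
  then show thesis
    by (rule that)
qed

text \<open>In \<open>hit\<close> the constant \<open>c\<close> is chosen before \<open>N\<close>:
  the proportion of good points must not decay with \<open>n\<close>, since it competes with mean
  discrepancies tending to 0. Stage \<open>N\<close> treats the first \<open>N + 1\<close> functions
  with tolerance \<open>1 / (N + 1)\<close>, so a limit point of the vectors found is a zero for the
  whole countable family.\<close>

lemma common_zero_of_discrepancies:
  fixes F :: "nat \<Rightarrow> real \<Rightarrow> 'g \<Rightarrow> real"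
  assumes F: "\<And>i. admissible (F i)" "\<And>i. invariant (F i)" and \<Lambda>: "closed \<Lambda>"
    and hit: "\<And>e. e > 0 \<Longrightarrow> \<exists>c>0. \<forall>N. \<exists>n\<ge>N.
      c \<le> measure lborel {x\<in>{0..<1}. \<exists>k\<in>\<Lambda>. norm (S n x - v - k) < e}"
  obtains w where "w - v \<in> \<Lambda>" "norm w \<le> C" "\<And>i. discrepancy (F i) w = 0"
proof -
  have "\<exists>w k. norm w \<le> C \<and> k \<in> \<Lambda> \<and> norm (w - v - k) < 1 / real (Suc N) \<and>
      (\<forall>i\<le>N. discrepancy (F i) w < 1 / real (Suc N))" for N
  proof -
    define e where "e = 1 / real (Suc N)"
    have e: "e > 0"
      by (simp add: e_def)
    obtain c where c: "c > 0" "\<And>N. \<exists>n\<ge>N. c \<le> measure lborel {x\<in>{0..<1}. \<exists>k\<in>\<Lambda>. norm (S n x - v - k) < e}"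
      using hit[OF e] by blast
    define E where "E n x = (\<Sum>i\<le>N. discrepancy (F i) (S n x))" for n x
    have i: "integrable circle_measure (\<lambda>x. discrepancy (F i) (S n x))" for i n
    proof -
      obtain B where B: "\<And>h. \<bar>discrepancy (F i) h\<bar> \<le> B"
        using discrepancy_bounded[OF F(1)] by blast
      show ?thesis
        using discrepancy_measurable[OF F(1)]
        by (intro circle_integrable_bounded[where B = B]) (auto intro!: B measurable_compose[OF S_measurable])
    qed
    have "(\<lambda>n. \<Sum>i\<le>N. \<integral>x. discrepancy (F i) (S n x) \<partial>circle_measure) \<longlonglongrightarrow> (\<Sum>i\<le>N. 0)"
      by (intro tendsto_sum discrepancy_S_tendsto_0 F)
    then have "(\<lambda>n. \<integral>x. E n x \<partial>circle_measure) \<longlonglongrightarrow> 0"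
      unfolding E_def using i by simp
    \<comment> \<open>Markov's inequality: if \<open>E n\<close> were at least \<open>e\<close> on a
      set of measure at least \<open>c\<close>, its mean would be at least
      \<open>c * e\<close>.\<close>
    then have "\<forall>\<^sub>F n in sequentially. (\<integral>x. E n x \<partial>circle_measure) < c * e"
      using c(1) e by (intro order_tendstoD(2)) auto
    then obtain M where M: "\<And>n. n \<ge> M \<Longrightarrow> (\<integral>x. E n x \<partial>circle_measure) < c * e"
      by (auto simp: eventually_sequentially)
    obtain n where n: "n \<ge> M" "c \<le> measure lborel {x\<in>{0..<1}. \<exists>k\<in>\<Lambda>. norm (S n x - v - k) < e}"
      using c(2) by blast
    let ?G = "{x\<in>{0..<1}. \<exists>k\<in>\<Lambda>. norm (S n x - v - k) < e}"
    have "\<exists>x\<in>?G. E n x < e"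
    proof (rule ccontr)
      assume "\<not> ?thesis"
      then have ge: "e \<le> E n x" if "x \<in> ?G" for x
        using that by force
      have "open (\<Union>k\<in>\<Lambda>. {u. norm (u - v - k) < e})"
        by (intro open_UN ballI open_Collect_less continuous_intros)
      then have "(\<Union>k\<in>\<Lambda>. {u. norm (u - v - k) < e}) \<in> sets borel"
        by simp
      from measurable_sets_borel[OF S_measurable this, of n]
      have "S n -` (\<Union>k\<in>\<Lambda>. {u. norm (u - v - k) < e}) \<inter> {0..<1} \<in> sets borel"
        by auto
      also have "S n -` (\<Union>k\<in>\<Lambda>. {u. norm (u - v - k) < e}) \<inter> {0..<1} = ?G"
        by auto
      finally have G: "?G \<in> sets circle_measure"
        by (auto simp: sets_circle_measure)
      have "c * e \<le> measure lborel ?G * e"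
        using n(2) e by simp
      also have "measure lborel ?G = measure circle_measure ?G"
        unfolding measure_def by (subst emeasure_circle_measure) auto
      also have "measure circle_measure ?G * e = (\<integral>x. indicator ?G x * e \<partial>circle_measure)"
        using sets.sets_into_space[OF G] by (simp add: Int_absorb2)
      also have "\<dots> \<le> (\<integral>x. E n x \<partial>circle_measure)"
      proof (rule integral_mono')
        show "indicator ?G x * e \<le> E n x" for x
          using ge[of x] by (auto simp: indicator_def E_def intro!: sum_nonneg discrepancy_nonneg)
      qed (use i in \<open>auto simp: E_def intro!: sum_nonneg discrepancy_nonneg\<close>)
      also have "\<dots> < c * e"
        by (rule M[OF n(1)])
      finally show False by simp
    qed
    then obtain x k where x: "k \<in> \<Lambda>" "norm (S n x - v - k) < e" "E n x < e"
      by blast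
    have "discrepancy (F i) (S n x) \<le> E n x" if "i \<le> N" for i
      unfolding E_def using that by (intro member_le_sum) (auto simp: discrepancy_nonneg)
    then show ?thesis
      using x S_bounded[of n x] unfolding e_def by (meson order_le_less_trans)
  qed
  then obtain w k where w: "\<And>N. norm (w N) \<le> C" "\<And>N. k N \<in> \<Lambda>"
      "\<And>N. norm (w N - v - k N) < 1 / real (Suc N)"
      "\<And>N i. i \<le> N \<Longrightarrow> discrepancy (F i) (w N) < 1 / real (Suc N)"
    by metis
  have "\<forall>N. w N \<in> cball 0 C"
    using w(1) by simp
  then obtain l r where l: "l \<in> cball 0 C" "strict_mono r" "(w \<circ> r) \<longlonglongrightarrow> l"
    using compact_cball[of "0 :: 'g" C] unfolding compact_def by blast
  have to0: "(\<lambda>N. 1 / real (Suc (r N))) \<longlonglongrightarrow> 0"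
    using LIMSEQ_subseq_LIMSEQ[OF LIMSEQ_inverse_real_of_nat l(2)] by (simp add: o_def inverse_eq_divide)
  show thesis
  proof
    have "(\<lambda>N. w (r N) - v - k (r N)) \<longlonglongrightarrow> 0"
      using to0 by (rule Lim_null_comparison[rotated]) (intro always_eventually allI less_imp_le w(3))
    from tendsto_diff[OF tendsto_diff[OF l(3)[unfolded o_def] tendsto_const[of v]] this]
    have "(\<lambda>N. k (r N)) \<longlonglongrightarrow> l - v"
      by simp
    then show "l - v \<in> \<Lambda>"
      using closed_sequentially[OF \<Lambda>, of "\<lambda>N. k (r N)"] w(2) by blast
    show "norm l \<le> C"
      using l(1) by simp
    fix i
    have "isCont (discrepancy (F i)) l"
      using continuous_discrepancy[OF F(1)] by (simp add: continuous_on_eq_continuous_at)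
    from isCont_tendsto_compose[OF this l(3)]
    have "(\<lambda>N. discrepancy (F i) (w (r N))) \<longlonglongrightarrow> discrepancy (F i) l"
      by (simp add: o_def)
    moreover have "(\<lambda>N. discrepancy (F i) (w (r N))) \<longlonglongrightarrow> 0"
    proof (rule real_tendsto_sandwich[OF _ _ tendsto_const to0])
      show "\<forall>\<^sub>F N in sequentially. discrepancy (F i) (w (r N)) \<le> 1 / real (Suc (r N))"
        using eventually_ge_at_top[of i]
      proof eventually_elim
        case (elim N)
        then have "i \<le> r N"
          using seq_suble[OF l(2), of N] by simp
        from w(4)[OF this] show ?case by simp
      qed
    qed (simp add: discrepancy_nonneg)
    ultimately show "discrepancy (F i) l = 0"
      by (rule LIMSEQ_unique)
  qed
qed

section \<open>Fibre windows of an invariant set and its group of periods\<close>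

definition fibre_window :: "(real \<times> 'g) set \<Rightarrow> 'g set \<Rightarrow> real \<Rightarrow> 'g \<Rightarrow> real" where
  "fibre_window A Q x g = window Q {s. (frac x, s) \<in> A} g"

lemma section_borel: "A \<in> sets (circle_measure \<Otimes>\<^sub>M borel) \<Longrightarrow> {s. (y, s) \<in> A} \<in> sets borel"
  using sets_Pair1[of A circle_measure borel y] by (simp add: vimage_def)

text \<open>Joint measurability comes from writing the window as a parameter integral; the modulus
  common to all \<open>x\<close> comes from the window estimate being uniform in the set.\<close>

lemma admissible_fibre_window:
  assumes A [measurable]: "A \<in> sets (circle_measure \<Otimes>\<^sub>M (borel :: 'g measure))" and Q: "Q \<in> rat_boxes"
  shows "admissible (fibre_window A Q)"
proof -
  have [measurable]: "Q \<in> sets borel"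
    by (rule rat_boxes_borel[OF Q])
  have "fibre_window A Q x g = (\<integral>s. indicator Q s * indicator A (frac x, s + g) \<partial>lborel)" for x g
    unfolding fibre_window_def window_integral[OF rat_boxes_borel[OF Q] section_borel[OF A]]
    by (simp add: indicator_def)
  then have "(\<lambda>(x, g). fibre_window A Q x g)
      = (\<lambda>z. \<integral>s. indicator Q s * indicator A (frac (fst z), s + snd z) \<partial>lborel)"
    by auto
  moreover have "(\<lambda>z. \<integral>s. indicator Q s * indicator A (frac (fst z), s + snd z) \<partial>lborel :: real)
      \<in> borel_measurable (borel \<Otimes>\<^sub>M borel)"
    by measurable
  moreover have "fibre_window A Q (x + 1) g = fibre_window A Q x g" for x g
    by (simp add: fibre_window_def frac_def)
  moreover have "\<bar>fibre_window A Q x g\<bar> \<le> measure lborel Q" for x g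
    using window_le[OF _ section_borel[OF A] emeasure_rat_boxes[OF Q]]
    by (simp add: fibre_window_def window_nonneg rat_boxes_borel[OF Q])
  moreover have "\<exists>d>0. \<forall>x g h. dist g h < d \<longrightarrow> \<bar>fibre_window A Q x g - fibre_window A Q x h\<bar> < e"
    if e: "e > 0" for e
    using window_uniformly_continuous[OF rat_boxes_borel[OF Q] emeasure_rat_boxes[OF Q] e]
      section_borel[OF A] unfolding fibre_window_def by metis
  ultimately show ?thesis
    unfolding admissible_def by metis
qed

lemma skew_invariantD:
  assumes "\<And>y s. y \<in> {0..<1} \<Longrightarrow> (circle_rotation \<alpha> y, s + \<Phi> y) \<in> A \<longleftrightarrow> (y, s) \<in> A"
  shows "(frac (x + \<alpha>), s + \<Phi> x) \<in> A \<longleftrightarrow> (frac x, s) \<in> A"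
proof -
  have "frac ((frac x + \<alpha>) + of_int \<lfloor>x\<rfloor>) = frac (frac x + \<alpha>)"
    by (subst (1 2) frac_def) simp
  then have "frac (x + \<alpha>) = circle_rotation \<alpha> (frac x)"
    unfolding circle_rotation_def by (simp add: frac_def[of x])
  moreover have "\<Phi> (frac x) = \<Phi> x"
    by (rule periodic_frac(2)) (rule \<Phi>_periodic)
  ultimately show ?thesis
    using assms[of "frac x" s] by (simp add: frac_lt_1)
qed

lemma invariant_fibre_window:
  assumes "\<And>y s. y \<in> {0..<1} \<Longrightarrow> (circle_rotation \<alpha> y, s + \<Phi> y) \<in> A \<longleftrightarrow> (y, s) \<in> A"
  shows "invariant (fibre_window A Q)"
  unfolding invariant_def fibre_window_def window_def
  using skew_invariantD[OF assms] by (simp add: add.assoc[symmetric])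

text \<open>Countability of the rational boxes is used twice: one vector \<open>w\<close> serves all
  boxes, and one null set of base points \<open>y\<close> does. Equality of all these windows at
  heights \<open>w\<close> and 0 then makes \<open>w\<close> a period of the fibre over
  \<open>y\<close>.\<close>

lemma translate_period:
  assumes A [measurable]: "A \<in> sets (circle_measure \<Otimes>\<^sub>M (borel :: 'g measure))"
    and inv: "\<And>y s. y \<in> {0..<1} \<Longrightarrow> (circle_rotation \<alpha> y, s + \<Phi> y) \<in> A \<longleftrightarrow> (y, s) \<in> A"
    and \<Lambda>: "closed \<Lambda>"
    and hit: "\<And>e. e > 0 \<Longrightarrow> \<exists>c>0. \<forall>N. \<exists>n\<ge>N.
      c \<le> measure lborel {x\<in>{0..<1}. \<exists>k\<in>\<Lambda>. norm (S n x - v - k) < e}"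
  obtains w where "w - v \<in> \<Lambda>" "norm w \<le> C"
    "AE y in circle_measure. AE s in lborel. (y, s + w) \<in> A \<longleftrightarrow> (y, s) \<in> A"
proof -
  have ne: "(rat_boxes :: 'g set set) \<noteq> {}"
    by (auto simp: rat_boxes_def intro!: exI[of _ 0])
  let ?Q = "from_nat_into (rat_boxes :: 'g set set)"
  have Q: "?Q i \<in> rat_boxes" for i
    by (rule from_nat_into[OF ne])
  have adm: "admissible (fibre_window A (?Q i))" for i
    by (rule admissible_fibre_window[OF A Q])
  obtain w where w: "w - v \<in> \<Lambda>" "norm w \<le> C" "\<And>i. discrepancy (fibre_window A (?Q i)) w = 0"
    using common_zero_of_discrepancies[of "\<lambda>i. fibre_window A (?Q i)", OF adm invariant_fibre_window[OF inv] \<Lambda> hit]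
    by blast
  have "AE y in circle_measure. \<forall>i. fibre_window A (?Q i) y w = fibre_window A (?Q i) y 0"
    unfolding AE_all_countable using discrepancy_eq_0D[OF adm w(3)] by blast
  then have "AE y in circle_measure. AE s in lborel. (y, s + w) \<in> A \<longleftrightarrow> (y, s) \<in> A"
    using AE_space
  proof eventually_elim
    case (elim y)
    have y: "frac y = y"
      using elim(2) by (simp add: frac_eq_id)
    have "AE s in lborel. s + w \<in> {s. (y, s) \<in> A} \<longleftrightarrow> s \<in> {s. (y, s) \<in> A}"
    proof (rule AE_translate_iff_window[OF section_borel[OF A]])
      fix Q :: "'g set" assume "Q \<in> rat_boxes"
      then obtain i where "Q = ?Q i"
        using from_nat_into_surj[OF countable_rat_boxes] by metis
      then show "window Q {s. (y, s) \<in> A} w = window Q {s. (y, s) \<in> A} 0"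
        using elim(1) by (simp add: fibre_window_def y)
    qed
    then show ?case
      by simp
  qed
  with w show thesis
    using that by blast
qed

theorem skew_product_null_or_conull:
  assumes A [measurable]: "A \<in> sets (circle_measure \<Otimes>\<^sub>M (borel :: 'g measure))"
    and inv: "\<And>y s. y \<in> {0..<1} \<Longrightarrow> (circle_rotation \<alpha> y, s + \<Phi> y) \<in> A \<longleftrightarrow> (y, s) \<in> A"
    and \<Lambda>: "closed \<Lambda>" "\<And>r. finite (\<Lambda> \<inter> cball 0 r)"
    and hit: "\<And>v e. e > 0 \<Longrightarrow> \<exists>c>0. \<forall>N. \<exists>n\<ge>N.
      c \<le> measure lborel {x\<in>{0..<1}. \<exists>k\<in>\<Lambda>. norm (S n x - v - k) < e}"
  shows "(AE z in circle_measure \<Otimes>\<^sub>M lborel. z \<in> A) \<or> (AE z in circle_measure \<Otimes>\<^sub>M lborel. z \<notin> A)"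
proof -
  interpret P: pair_sigma_finite circle_measure "lborel :: 'g measure" ..
  have [measurable_cong]: "sets (circle_measure \<Otimes>\<^sub>M (lborel :: 'g measure)) = sets (circle_measure \<Otimes>\<^sub>M borel)"
    by (rule sets_pair_measure_cong) auto
  have [measurable]: "Measurable.pred (circle_measure \<Otimes>\<^sub>M borel) (\<lambda>z. z \<in> A)"
    using A by measurable
  have mA: "{z \<in> space (circle_measure \<Otimes>\<^sub>M lborel). z \<in> A} \<in> sets (circle_measure \<Otimes>\<^sub>M lborel)"
    and mA': "{z \<in> space (circle_measure \<Otimes>\<^sub>M lborel). z \<notin> A} \<in> sets (circle_measure \<Otimes>\<^sub>M lborel)"
    by measurable
  note sec = section_borel[OF A]
  define H where "H = {h. AE y in circle_measure. AE s in lborel. (y, s + h) \<in> A \<longleftrightarrow> (y, s) \<in> A}"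
  have "H = UNIV"
  proof (rule finite_index_subgroup_eq_UNIV)
    fix g h assume "g \<in> H" "h \<in> H"
    then have "AE y in circle_measure. AE s in lborel. (y, s + g) \<in> A \<longleftrightarrow> (y, s) \<in> A"
      "AE y in circle_measure. AE s in lborel. (y, s + h) \<in> A \<longleftrightarrow> (y, s) \<in> A"
      by (simp_all add: H_def)
    then have "AE y in circle_measure. AE s in lborel. (y, s + (g - h)) \<in> A \<longleftrightarrow> (y, s) \<in> A"
    proof eventually_elim
      case (elim y)
      have [measurable]: "Measurable.pred borel (\<lambda>s. (y, s) \<in> A)"
        using sec[of y] by (simp add: pred_def)
      have m: "Measurable.pred borel (\<lambda>s. ((y, s + u) \<in> A) = ((y, s) \<in> A))" for u
        by (intro pred_intros_logic measurable_compose[of "\<lambda>s. s + u" borel borel "\<lambda>s. (y, s) \<in> A"]) measurable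
      show ?case
        using AE_lborel_translate[OF m elim(1), of "- h"] AE_lborel_translate[OF m elim(2), of "- h"]
        by eventually_elim (simp add: algebra_simps)
    qed
    then show "g - h \<in> H"
      by (simp add: H_def)
  next
    show "finite (\<Lambda> \<inter> cball 0 (C + 1))"
      \<comment> \<open>The radius is \<open>C\<close> for the period \<open>w\<close> plus 1 for
        \<open>v\<close>, since the correction is \<open>w - v\<close>.\<close>
      by (rule \<Lambda>)
    fix v :: 'g assume v: "norm v \<le> 1"
    obtain w where w: "w - v \<in> \<Lambda>" "norm w \<le> C"
      "AE y in circle_measure. AE s in lborel. (y, s + w) \<in> A \<longleftrightarrow> (y, s) \<in> A"
      using translate_period[OF A inv \<Lambda>(1) hit] by blast
    have "norm (w - v) \<le> C + 1"
      using norm_triangle_ineq4[of w v] v w(2) by linarith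
    then show "\<exists>k\<in>\<Lambda> \<inter> cball 0 (C + 1). v + k \<in> H"
      using w by (intro bexI[of _ "w - v"]) (auto simp: H_def)
  qed
  then have H: "AE y in circle_measure. AE s in lborel. (y, s + h) \<in> A \<longleftrightarrow> (y, s) \<in> A" for h
    by (auto simp: H_def)
  have "AE y in circle_measure. (AE s in lborel. (y, s) \<in> A) \<or> (AE s in lborel. (y, s) \<notin> A)"
  proof (rule AE_null_or_conull_if_translation_invariant[OF _ A])
    show "AE z in circle_measure \<Otimes>\<^sub>M lborel. (fst z, snd z + h) \<in> A \<longleftrightarrow> z \<in> A" for h
    proof (rule P.AE_pair_measure)
      show "{z \<in> space (circle_measure \<Otimes>\<^sub>M lborel). ((fst z, snd z + h) \<in> A) = (z \<in> A)}
          \<in> sets (circle_measure \<Otimes>\<^sub>M lborel)"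
        by measurable
    qed (use H in simp)
  qed unfold_locales
  note dich = this
  \<comment> \<open>Base points with non-null fibre. Since \<open>A\<close> is invariant everywhere
    and translations preserve Lebesgue measure, \<open>B\<close> is invariant at every point, as the
    ergodicity lemma for the rotation demands.\<close>
  define B where "B = {y \<in> space circle_measure. emeasure lborel (Pair y -` A) \<noteq> 0}"
  have B: "B \<in> sets circle_measure"
    unfolding B_def using sigma_finite_measure.measurable_emeasure_Pair[OF sigma_finite_lborel, of A circle_measure] A by measurable
  have B_iff: "y \<in> B \<longleftrightarrow> \<not> (AE s in lborel. (y, s) \<notin> A)" if "y \<in> {0..<1}" for y
    using that sec[of y] by (subst AE_iff_measurable[of "Pair y -` A"]) (auto simp: B_def vimage_def)
  have rot: "circle_rotation \<alpha> y \<in> B \<longleftrightarrow> y \<in> B" if y: "y \<in> {0..<1}" for y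
  proof -
    have y': "circle_rotation \<alpha> y \<in> {0..<1}"
      by (simp add: circle_rotation_def frac_lt_1)
    have m: "Measurable.pred borel (\<lambda>s. (u, s) \<notin> A)" for u
      using sec[of u] by (intro pred_intros_logic) (simp add: pred_def)
    have *: "(AE s in lborel. P s) \<longleftrightarrow> (AE s in lborel. P (u + s))" if P: "Measurable.pred borel P" for P and u :: 'g
    proof
      assume "AE s in lborel. P (u + s)"
      moreover have "Measurable.pred borel (\<lambda>s. P (u + s))"
        using P by measurable
      ultimately show "AE s in lborel. P s"
        using AE_lborel_translate[of "\<lambda>s. P (u + s)" "- u"] by simp
    qed (rule AE_lborel_translate[OF P])
    show ?thesis
      unfolding B_iff[OF y] B_iff[OF y'] *[OF m, of "circle_rotation \<alpha> y" "\<Phi> y"]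
      using inv[OF y] by (simp add: add.commute)
  qed
  from circle_rotation_ergodic[OF irrational B rot] show ?thesis
  proof
    assume "AE y in circle_measure. y \<in> B"
    with dich AE_space have "AE y in circle_measure. AE s in lborel. (y, s) \<in> A"
      by eventually_elim (use B_iff in auto)
    then have "AE z in circle_measure \<Otimes>\<^sub>M lborel. z \<in> A"
      by (intro P.AE_pair_measure[OF mA]) simp
    then show ?thesis ..
  next
    assume "AE y in circle_measure. y \<notin> B"
    with AE_space have "AE y in circle_measure. AE s in lborel. (y, s) \<notin> A"
      by eventually_elim (use B_iff in auto)
    then have "AE z in circle_measure \<Otimes>\<^sub>M lborel. z \<notin> A"
      by (intro P.AE_pair_measure[OF mA']) simp
    then show ?thesis ..
  qed
qed

end

section \<open>Birkhoff sums of the sawtooth\<close>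

lemma psi_periodic: "psi (x + 1) = psi x"
  by (simp add: psi_def frac_def)

lemma psi_circle_rotation: "psi (circle_rotation b x) = psi (x + b)"
  by (simp add: psi_def circle_rotation_def)

text \<open>Multiplication by \<open>p\<close> permutes the residues modulo \<open>q\<close>, so the
  rational orbit is the equally spaced grid in another order.\<close>

lemma sum_rational_rotation:
  fixes u :: "real \<Rightarrow> 'a::comm_monoid_add"
  assumes per: "\<And>x. u (x + 1) = u x" and q: "q > 0" and cop: "coprime p (int q)"
  shows "(\<Sum>k<q. u (x + real k * of_int p / real q)) = (\<Sum>k<q. u (x + real k / real q))"
proof -
  let ?f = "\<lambda>k. nat ((int k * p) mod int q)"
  have inj: "inj_on ?f {..<q}"
  proof (rule inj_onI)
    fix k l assume k: "k \<in> {..<q}" "l \<in> {..<q}" and "?f k = ?f l"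
    then have "(int k * p) mod int q = (int l * p) mod int q"
      using q by (simp add: nat_eq_iff2)
    then have "int q dvd (int k - int l) * p"
      by (simp add: mod_eq_dvd_iff left_diff_distrib)
    then have "int q dvd int k - int l"
      using cop by (simp add: coprime_dvd_mult_left_iff coprime_commute)
    then have "int k mod int q = int l mod int q"
      by (simp add: mod_eq_dvd_iff)
    then show "k = l"
      using k by simp
  qed
  have "?f ` {..<q} \<subseteq> {..<q}"
    using q by (auto simp: nat_less_iff)
  then have bij: "bij_betw ?f {..<q} {..<q}"
    using inj by (simp add: bij_betw_def endo_inj_surj)
  have "u (x + real k * of_int p / real q) = u (x + real (?f k) / real q)" for k
  proof -
    have "real_of_int (int k * p) = of_int (int q * ((int k * p) div int q) + (int k * p) mod int q)"
      by (simp only: mult_div_mod_eq)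
    also have "\<dots> = real q * of_int ((int k * p) div int q) + of_int ((int k * p) mod int q)"
      by (simp only: of_int_add of_int_mult of_int_of_nat_eq)
    finally have "real k * of_int p / real q = of_int ((int k * p) mod int q) / real q + of_int ((int k * p) div int q)"
      using q by (simp add: field_simps)
    also have "of_int ((int k * p) mod int q) = real (?f k)"
      using q by simp
    finally show ?thesis
      using periodic_frac(1)[of u, OF per] by (simp flip: add.assoc)
  qed
  then have "(\<Sum>k<q. u (x + real k * of_int p / real q)) = (\<Sum>k<q. u (x + real (?f k) / real q))"
    by simp
  also have "\<dots> = (\<Sum>k<q. u (x + real k / real q))"
    by (rule sum.reindex_bij_betw[OF bij, where g = "\<lambda>k. u (x + real k / real q)"])
  finally show ?thesis .
qed

text \<open>Hermite's identity. As a function of \<open>y = q x\<close>, the difference of the two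
  sides has period 1, because a unit step shifts the grid by one place and telescopes; for
  \<open>y\<close> in [0,1) every floor is 0.\<close>

lemma sum_floor_hermite:
  assumes q: "q > 0"
  shows "(\<Sum>j<q. \<lfloor>x + real j / real q\<rfloor>) = \<lfloor>real q * x\<rfloor>"
proof -
  define g where "g y = (\<Sum>j<q. \<lfloor>y / real q + real j / real q\<rfloor>) - \<lfloor>y\<rfloor>" for y
  have "g (y + 1) = g y" for y
  proof -
    have "(\<Sum>j<q. \<lfloor>(y + 1) / real q + real j / real q\<rfloor>) - (\<Sum>j<q. \<lfloor>y / real q + real j / real q\<rfloor>)
        = (\<Sum>j<q. \<lfloor>y / real q + real (Suc j) / real q\<rfloor> - \<lfloor>y / real q + real j / real q\<rfloor>)"
      by (simp add: sum_subtractf add_divide_distrib algebra_simps)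
    also have "\<dots> = \<lfloor>y / real q + real q / real q\<rfloor> - \<lfloor>y / real q + real 0 / real q\<rfloor>"
      by (rule sum_lessThan_telescope)
    also have "\<dots> = 1"
      using q by simp
    finally show ?thesis
      by (simp add: g_def)
  qed
  then have "g (real q * x) = g (frac (real q * x))"
    by (simp add: periodic_frac(2)[of g])
  also have "g (frac y) = 0" for y
  proof -
    have "\<lfloor>frac y / real q + real j / real q\<rfloor> = 0" if "j < q" for j
    proof -
      have "frac y + real j < real q"
        using frac_lt_1[of y] that by linarith
      then show ?thesis
        using q by (auto simp: floor_eq_iff add_divide_distrib[symmetric])
    qed
    then have "(\<Sum>j<q. \<lfloor>frac y / real q + real j / real q\<rfloor>) = 0"
      by (intro sum.neutral) auto
    then show ?thesis
      by (simp add: g_def floor_eq_iff frac_lt_1)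
  qed
  finally show ?thesis
    using q by (simp add: g_def)
qed

text \<open>The multiplication formula of the first Bernoulli polynomial, of which
  \<open>psi\<close> is the periodic extension.\<close>

lemma sum_psi_multiplication:
  assumes q: "q > 0"
  shows "(\<Sum>j<q. psi (x + real j / real q)) = psi (real q * x)"
proof -
  have gauss: "(\<Sum>j<n. real j) = real n * (real n - 1) / 2" for n
    by (induction n) (simp_all add: field_simps)
  have "(\<Sum>j<q. psi (x + real j / real q))
      = (\<Sum>j<q. (x - 1 / 2) + real j / real q) - of_int (\<Sum>j<q. \<lfloor>x + real j / real q\<rfloor>)"
    unfolding of_int_sum sum_subtractf[symmetric]
    by (intro sum.cong) (simp_all add: psi_def frac_def)
  also have "(\<Sum>j<q. (x - 1 / 2) + real j / real q) = real q * (x - 1 / 2) + (real q - 1) / 2"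
    using q by (simp add: sum.distrib sum_divide_distrib[symmetric] gauss)
  also have "(\<Sum>j<q. \<lfloor>x + real j / real q\<rfloor>) = \<lfloor>real q * x\<rfloor>"
    by (rule sum_floor_hermite[OF q])
  finally show ?thesis
    by (simp add: psi_def frac_def field_simps)
qed

text \<open>The floor differences in the error term \<open>I\<close> below count the jumps of \<open>psi\<close> crossed when the
  orbit is replaced by a rational one; summed over the rational orbit they telescope to 1 each.\<close>
lemma abs_sum_psi_le:
  assumes q: "q > 0" and cop: "coprime p (int q)" and close: "\<bar>real q * \<alpha> - of_int p\<bar> < 1 / real q"
  shows "\<bar>\<Sum>k<q. psi (x + real k * \<alpha>)\<bar> \<le> 4"
proof -
  define y where "y k = x + real k * of_int p / real q" for k
  define I where "I z = (1 / real q + of_int (\<lfloor>z\<rfloor> - \<lfloor>z - 1 / real q\<rfloor>) + of_int (\<lfloor>z + 1 / real q\<rfloor> - \<lfloor>z\<rfloor>) :: real)" for z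
  have I_per: "I (z + 1) = I z" for z
  proof -
    have "\<lfloor>z + 1 - 1 / real q\<rfloor> = \<lfloor>z - 1 / real q\<rfloor> + 1" "\<lfloor>z + 1 + 1 / real q\<rfloor> = \<lfloor>z + 1 / real q\<rfloor> + 1"
      by linarith+
    then show ?thesis
      by (simp add: I_def)
  qed
  have pw: "\<bar>psi (x + real k * \<alpha>) - psi (y k)\<bar> \<le> I (y k)" if "k < q" for k
  proof -
    define s where "s = real k * \<alpha> - real k * of_int p / real q"
    have "s = real k / real q * (real q * \<alpha> - of_int p)"
      using q by (simp add: s_def field_simps)
    then have "\<bar>s\<bar> = real k / real q * \<bar>real q * \<alpha> - of_int p\<bar>"
      using q by (simp add: abs_mult)
    also have "\<dots> \<le> 1 * \<bar>real q * \<alpha> - of_int p\<bar>"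
      using that q by (intro mult_right_mono) auto
    finally have "\<bar>s\<bar> \<le> \<bar>real q * \<alpha> - of_int p\<bar>"
      by simp
    then have s: "\<bar>s\<bar> \<le> 1 / real q"
      using close by (rule order_trans[OF _ less_imp_le])
    have eq: "x + real k * \<alpha> = y k + s"
      by (simp add: y_def s_def)
    have "\<lfloor>y k + s\<rfloor> \<le> \<lfloor>y k + 1 / real q\<rfloor>" "\<lfloor>y k - 1 / real q\<rfloor> \<le> \<lfloor>y k + s\<rfloor>"
      "\<lfloor>y k - 1 / real q\<rfloor> \<le> \<lfloor>y k\<rfloor>" "\<lfloor>y k\<rfloor> \<le> \<lfloor>y k + 1 / real q\<rfloor>"
      using s by (auto intro!: floor_mono)
    then show ?thesis
      using s unfolding eq I_def psi_def frac_def by linarith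
  qed
  have "(\<Sum>k<q. I (y k)) = (\<Sum>k<q. I (x + real k / real q))"
    unfolding y_def by (rule sum_rational_rotation[of I, OF I_per q cop])
  also have "\<dots> = (\<Sum>k<q. 1 / real q) + of_int (\<Sum>k<q. \<lfloor>x + real k / real q\<rfloor> - \<lfloor>x + real k / real q - 1 / real q\<rfloor>)
      + of_int (\<Sum>k<q. \<lfloor>x + real k / real q + 1 / real q\<rfloor> - \<lfloor>x + real k / real q\<rfloor>)"
    by (simp only: I_def of_int_sum sum.distrib)
  also have "(\<Sum>k<q. \<lfloor>x + real k / real q + 1 / real q\<rfloor> - \<lfloor>x + real k / real q\<rfloor>)
      = (\<Sum>k<q. \<lfloor>x + real (Suc k) / real q\<rfloor> - \<lfloor>x + real k / real q\<rfloor>)"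
    by (simp add: add_divide_distrib algebra_simps)
  also have "\<dots> = \<lfloor>x + real q / real q\<rfloor> - \<lfloor>x + real 0 / real q\<rfloor>"
    by (rule sum_lessThan_telescope)
  also have "\<dots> = 1"
    using q by simp
  also have "(\<Sum>k<q. \<lfloor>x + real k / real q\<rfloor> - \<lfloor>x + real k / real q - 1 / real q\<rfloor>)
      = (\<Sum>k<q. \<lfloor>(x - 1 / real q) + real (Suc k) / real q\<rfloor> - \<lfloor>(x - 1 / real q) + real k / real q\<rfloor>)"
    by (simp add: add_divide_distrib algebra_simps)
  also have "\<dots> = \<lfloor>(x - 1 / real q) + real q / real q\<rfloor> - \<lfloor>(x - 1 / real q) + real 0 / real q\<rfloor>"
    by (rule sum_lessThan_telescope)
  also have "\<dots> = 1"
    using q by simp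
  finally have I3: "(\<Sum>k<q. I (y k)) = 3"
    using q by simp
  have "(\<Sum>k<q. psi (y k)) = psi (real q * x)"
    unfolding y_def sum_rational_rotation[of psi, OF psi_periodic q cop] by (rule sum_psi_multiplication[OF q])
  moreover have "\<bar>psi (real q * x)\<bar> \<le> 1 / 2"
    using frac_lt_1[of "real q * x"] frac_ge_0[of "real q * x"] unfolding psi_def by linarith
  moreover have "\<bar>(\<Sum>k<q. psi (x + real k * \<alpha>)) - (\<Sum>k<q. psi (y k))\<bar> \<le> (\<Sum>k<q. I (y k))"
    unfolding sum_subtractf[symmetric] using pw by (intro order_trans[OF sum_abs] sum_mono) auto
  \<comment> \<open>The rational orbit contributes at most 1/2 and the replacement at most 3; 4 is a
    round bound.\<close>
  ultimately show ?thesis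
    using I3 by linarith
qed

text \<open>Modulo integers \<open>psi\<close> is \<open>x - 1 / 2\<close>, so the sum is affine in
  \<open>x\<close> with a constant independent of \<open>x\<close>. Evaluated at a point shifted by
  \<open>b\<close>, it exceeds the unshifted sum by \<open>q b\<close> modulo 1.\<close>

lemma sum_psi_mod_1:
  "\<exists>k::int. (\<Sum>i<q. psi (x + real i * \<alpha>)) = real q * x + (\<Sum>i<q. real i * \<alpha> - 1 / 2) + of_int k"
proof
  show "(\<Sum>i<q. psi (x + real i * \<alpha>))
      = real q * x + (\<Sum>i<q. real i * \<alpha> - 1 / 2) + of_int (- (\<Sum>i<q. \<lfloor>x + real i * \<alpha>\<rfloor>))"
    by (simp add: psi_def frac_def sum_subtractf sum.distrib)
qed

text \<open>The bound does not depend on \<open>q\<close>: \<open>q\<close> intervals of length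
  \<open>\<eta> / q\<close>, one in each period of the affine map. The full set has measure
  \<open>2 * \<eta>\<close>; half of it suffices and avoids wrapping around the endpoints.\<close>

lemma measure_affine_near_Ints:
  assumes q: "q > 0" and \<eta>: "0 < \<eta>" "\<eta> \<le> 1 / 2"
  shows "\<eta> \<le> measure lborel {x\<in>{0..<1}. \<exists>z::int. \<bar>real q * x + a - of_int z\<bar> < \<eta>}" (is "_ \<le> measure _ ?G")
proof -
  define t where "t = frac (- a)"
  \<comment> \<open>Takes the half-neighbourhood to the right of \<open>t\<close> if
    \<open>t \<le> 1 / 2\<close> and to the left otherwise, so that it stays inside [0,1].\<close>
  define t' where "t' = (if t \<le> 1 / 2 then t else t - \<eta>)"
  have t: "0 \<le> t" "t < 1"
    by (simp_all add: t_def frac_lt_1)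
  have t': "0 \<le> t'" "t' + \<eta> \<le> 1" "\<bar>u - t'\<bar> < \<eta> \<Longrightarrow> t' < u \<Longrightarrow> u < t' + \<eta> \<Longrightarrow> \<bar>u - t\<bar> < \<eta>" for u
    using t \<eta> by (auto simp: t'_def abs_less_iff split: if_splits)
  define J where "J j = {(t' + real j) / real q <..< (t' + real j + \<eta>) / real q}" for j
  have "J j \<in> sets lborel" for j
    by (simp add: J_def)
  have JG: "J j \<subseteq> ?G" if "j < q" for j
  proof
    fix x assume "x \<in> J j"
    then have x: "t' + real j < real q * x" "real q * x < t' + real j + \<eta>"
      using q by (auto simp: J_def field_simps)
    have "\<bar>(real q * x - real j) - t\<bar> < \<eta>"
      using x by (intro t'(3)) auto
    then have "\<bar>real q * x + a - of_int (int j - \<lfloor>- a\<rfloor>)\<bar> < \<eta>"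
      by (simp add: t_def frac_def algebra_simps)
    moreover have "0 \<le> real q * x" "real q * x < real q * 1"
      using x t' that by linarith+
    then have "0 \<le> x" "x < 1"
      using q by (simp_all add: zero_le_mult_iff)
    ultimately show "x \<in> ?G"
      by (simp only: mem_Collect_eq atLeastLessThan_iff) blast
  qed
  have "disjoint_family_on J {..<q}"
  proof (unfold disjoint_family_on_def, intro ballI impI)
    fix i j :: nat assume "i \<noteq> j"
    then have "real i + 1 \<le> real j \<or> real j + 1 \<le> real i"
      by linarith
    moreover have "False" if "x \<in> J i" "x \<in> J j" "real i + 1 \<le> real j" for x and i j :: nat
      using that q \<eta> by (auto simp: J_def field_simps)
    ultimately show "J i \<inter> J j = {}"
      by blast
  qed
  then have "emeasure lborel (\<Union>j<q. J j) = (\<Sum>j<q. emeasure lborel (J j))"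
    using \<open>\<And>j. J j \<in> sets lborel\<close> by (intro sum_emeasure[symmetric]) auto
  also have "\<dots> = (\<Sum>j<q. ennreal (\<eta> / real q))"
    using q \<eta> by (intro sum.cong) (auto simp: J_def divide_right_mono diff_divide_distrib[symmetric])
  also have "\<dots> = ennreal (\<Sum>j<q. \<eta> / real q)"
    using \<eta> by (intro sum_ennreal) auto
  also have "(\<Sum>j<q. \<eta> / real q) = \<eta>"
    using q by simp
  finally have "\<eta> = measure lborel (\<Union>j<q. J j)"
    using \<eta> by (simp add: measure_def)
  also have "\<dots> \<le> measure lborel ?G"
  proof (rule measure_mono_fmeasurable)
    show "(\<Union>j<q. J j) \<subseteq> ?G"
      using JG by blast
    show "(\<Union>j<q. J j) \<in> sets lborel"
      by (auto simp: J_def)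
    have [measurable]: "?G \<in> sets borel"
      by measurable
    have "emeasure lborel ?G \<le> emeasure lborel {0..<1::real}"
      by (intro emeasure_mono) auto
    then show "?G \<in> fmeasurable lborel"
      by (auto simp: fmeasurable_def intro: order_le_less_trans)
  qed
  finally show ?thesis .
qed

section \<open>Ergodicity when the multiples are dense\<close>

text \<open>Slicing over the base: each fibre of the preimage is a translate of a fibre of
  \<open>A\<close>, and the remaining integral over the base is invariant under the
  rotation.\<close>

lemma skew_product_rotation_measure_preserving:
  fixes \<Phi> :: "real \<Rightarrow> 'g::euclidean_space"
  assumes [measurable]: "\<Phi> \<in> borel_measurable borel"
  shows "skew_product (circle_rotation \<alpha>) \<Phi> \<in> circle_measure \<Otimes>\<^sub>M lborel \<rightarrow>\<^sub>M circle_measure \<Otimes>\<^sub>M lborel" (is ?meas)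
    and "distr (circle_measure \<Otimes>\<^sub>M lborel) (circle_measure \<Otimes>\<^sub>M lborel) (skew_product (circle_rotation \<alpha>) \<Phi>)
      = circle_measure \<Otimes>\<^sub>M lborel" (is ?distr)
proof -
  let ?T = "circle_rotation \<alpha>" and ?M = "circle_measure \<Otimes>\<^sub>M (lborel :: 'g measure)"
  have [measurable]: "\<Phi> \<in> borel_measurable circle_measure"
    by (rule measurable_circle_if_borel) simp
  have [measurable]: "?T \<in> circle_measure \<rightarrow>\<^sub>M circle_measure"
    unfolding circle_rotation_def[abs_def] by measurable
  show meas: ?meas
    unfolding skew_product_def by measurable
  show ?distr
  proof (rule measure_eqI)
    fix A assume "A \<in> sets (distr ?M ?M (skew_product ?T \<Phi>))"
    then have A [measurable]: "A \<in> sets ?M"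
      by simp
    have f [measurable]: "(\<lambda>y. emeasure lborel (Pair y -` A)) \<in> borel_measurable circle_measure"
      by (rule sigma_finite_measure.measurable_emeasure_Pair[OF sigma_finite_lborel A])
    have slice: "emeasure lborel (Pair y -` (skew_product ?T \<Phi> -` A \<inter> space ?M)) = emeasure lborel (Pair (?T y) -` A)"
      if y: "y \<in> space circle_measure" for y
    proof -
      have [measurable]: "Pair (?T y) -` A \<in> sets borel"
        using sets_Pair1[OF A] by simp
      have "Pair y -` (skew_product ?T \<Phi> -` A \<inter> space ?M) = (+) (\<Phi> y) -` (Pair (?T y) -` A)"
        using y by (auto simp: skew_product_def space_pair_measure add.commute)
      also have "emeasure lborel \<dots> = emeasure (distr lborel borel ((+) (\<Phi> y))) (Pair (?T y) -` A)"
        by (subst emeasure_distr) auto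
      finally show ?thesis
        by (simp add: lborel_distr_plus)
    qed
    have "emeasure (distr ?M ?M (skew_product ?T \<Phi>)) A = emeasure ?M (skew_product ?T \<Phi> -` A \<inter> space ?M)"
      by (rule emeasure_distr[OF meas A])
    also have "\<dots> = (\<integral>\<^sup>+ y. emeasure lborel (Pair y -` (skew_product ?T \<Phi> -` A \<inter> space ?M)) \<partial>circle_measure)"
      by (rule sigma_finite_measure.emeasure_pair_measure_alt[OF sigma_finite_lborel measurable_sets[OF meas A]])
    also have "\<dots> = (\<integral>\<^sup>+ y. emeasure lborel (Pair (?T y) -` A) \<partial>circle_measure)"
      by (intro nn_integral_cong slice)
    also have "\<dots> = (\<integral>\<^sup>+ y. emeasure lborel (Pair y -` A) \<partial>distr circle_measure circle_measure ?T)"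
      by (rule nn_integral_distr[symmetric]) simp_all
    also have "distr circle_measure circle_measure ?T = circle_measure"
      unfolding circle_rotation_def[abs_def] by (rule distr_circle_rotation)
    also have "(\<integral>\<^sup>+ y. emeasure lborel (Pair y -` A) \<partial>circle_measure) = emeasure ?M A"
      by (rule sigma_finite_measure.emeasure_pair_measure_alt[OF sigma_finite_lborel A, symmetric])
    finally show "emeasure (distr ?M ?M (skew_product ?T \<Phi>)) A = emeasure ?M A" .
  qed simp
qed

section \<open>The sawtooth cocycle in coordinates and the integer lattice\<close>

definition offset :: "('d \<Rightarrow> real) \<Rightarrow> 'd option \<Rightarrow> real" where
  "offset \<beta> j = (case j of None \<Rightarrow> 0 | Some i \<Rightarrow> \<beta> i)"

lemma psi_cocycle_nth: "psi_cocycle \<beta> x $ j = psi (x + offset \<beta> j)"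
  by (cases j) (simp_all add: psi_cocycle_def offset_def psi_circle_rotation)

lemma isCont_psi: "x \<notin> \<int> \<Longrightarrow> isCont psi x"
  unfolding psi_def[abs_def] by (intro continuous_intros continuous_frac)

lemma countable_discontinuities_psi_cocycle: "countable {x. \<not> isCont (psi_cocycle \<beta>) x}"
proof (rule countable_subset)
  show "{x. \<not> isCont (psi_cocycle \<beta>) x} \<subseteq> (\<Union>j. (\<lambda>z. z - offset \<beta> j) ` \<int>)"
  proof (rule ccontr)
    assume "\<not> ?thesis"
    then obtain x where x: "\<not> isCont (psi_cocycle \<beta>) x" "x \<notin> (\<Union>j. (\<lambda>z. z - offset \<beta> j) ` \<int>)"
      by blast
    have "isCont (\<lambda>x. psi (x + offset \<beta> j)) x" for j
    proof -
      have "x + offset \<beta> j \<notin> \<int>"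
        using x(2) by (auto simp: image_iff) (metis add_diff_cancel_right')
      then have "isCont psi (x + offset \<beta> j)"
        by (rule isCont_psi)
      then show ?thesis
        by (intro isCont_o2[where f = "\<lambda>x. x + offset \<beta> j" and g = psi]) auto
    qed
    then have "isCont (psi_cocycle \<beta>) x"
      unfolding isCont_def by (intro vec_tendstoI) (simp add: psi_cocycle_nth)
    with x(1) show False ..
  qed
  show "countable (\<Union>j. (\<lambda>z. z - offset \<beta> j) ` \<int>)"
    by (intro countable_UN countable_image countable_int) simp
qed

lemma psi_cocycle_measurable [measurable]: "psi_cocycle \<beta> \<in> borel_measurable borel"
proof -
  have [measurable]: "psi \<in> borel_measurable borel"
    unfolding psi_def[abs_def] by measurable
  show ?thesis
    by (subst borel_measurable_euclidean_space) (auto simp: Basis_vec_def inner_axis psi_cocycle_nth)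
qed

definition integer_lattice :: "(real ^ 'n::finite) set" where
  "integer_lattice = {k. \<forall>j. k $ j \<in> \<int>}"

lemma closed_integer_lattice: "closed integer_lattice"
proof -
  have "closed {k :: real ^ 'n. k $ j \<in> \<int>}" for j
    using continuous_closed_vimage[OF closed_Ints, of "\<lambda>k. k $ j"] by (simp add: vimage_def)
  then show ?thesis
    unfolding integer_lattice_def by (intro closed_Collect_all)
qed

lemma finite_integer_lattice_cball: "finite (integer_lattice \<inter> cball 0 r)"
proof (rule finite_subset)
  let ?I = "(of_int :: int \<Rightarrow> real) ` {- \<lceil>r\<rceil>..\<lceil>r\<rceil>}"
  show "integer_lattice \<inter> cball 0 r \<subseteq> (\<lambda>f. \<chi> j. f j) ` (UNIV \<rightarrow>\<^sub>E ?I)"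
  proof
    fix k :: "real ^ 'n" assume k: "k \<in> integer_lattice \<inter> cball 0 r"
    have "k $ j \<in> ?I" for j
    proof -
      obtain m :: int where m: "k $ j = of_int m"
        using k by (auto simp: integer_lattice_def Ints_def)
      have "\<bar>of_int m\<bar> \<le> r"
        using k component_le_norm_cart[of k j] by (simp add: m)
      then have "- \<lceil>r\<rceil> \<le> m" "m \<le> \<lceil>r\<rceil>"
        by linarith+
      then show ?thesis
        by (simp add: m)
    qed
    then show "k \<in> (\<lambda>f. \<chi> j. f j) ` (UNIV \<rightarrow>\<^sub>E ?I)"
      by (intro image_eqI[of _ _ "\<lambda>j. k $ j"]) (auto simp: vec_eq_iff)
  qed
  show "finite ((\<lambda>f. \<chi> j. f j) ` (UNIV \<rightarrow>\<^sub>E ?I) :: (real ^ 'n) set)"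
    by (intro finite_imageI finite_PiE) auto
qed

text \<open>To bring \<open>S n x\<close> near \<open>v\<close> modulo the lattice, density chooses
  \<open>n\<close> with \<open>q n * \<beta> i\<close> near \<open>v $ Some i - v $ None\<close>.
  All coordinates are then correct as soon as the unshifted one is near \<open>v $ None\<close>, and
  this single affine condition on \<open>x\<close> has measure bounded below independently of
  \<open>n\<close>.\<close>

lemma psi_cocycle_ergodic:
  fixes \<beta> :: "'d::finite \<Rightarrow> real"
  assumes \<alpha>: "\<alpha> \<notin> \<rat>" and q: "\<And>n. q n > n" and cop: "\<And>n. coprime (p n) (int (q n))"
    and close: "\<And>n. \<bar>real (q n) * \<alpha> - of_int (p n)\<bar> < 1 / real (q n)"
    and dense: "\<And>\<theta> e N. e > 0 \<Longrightarrow> \<exists>n\<ge>N. \<forall>i. \<exists>z::int. \<bar>real (q n) * \<beta> i - \<theta> i - of_int z\<bar> < e"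
  shows "ergodic_cocycle circle_measure (circle_rotation \<alpha>) (psi_cocycle \<beta>)"
proof -
  have q0: "q n > 0" for n
    using q[of n] by linarith
  let ?m = "real CARD('d option)"
  have comp: "(\<Sum>i<k. psi_cocycle \<beta> (x + real i * \<alpha>)) $ j = (\<Sum>i<k. psi ((x + offset \<beta> j) + real i * \<alpha>))" for k x j
    by (simp add: psi_cocycle_nth algebra_simps)
  \<comment> \<open>A bound of 4 for each coordinate, added up by comparing the norm with the sum of
    absolute values.\<close>
  interpret bounded_rigidity \<alpha> "psi_cocycle \<beta>" q p "?m * 4"
  proof
    show "psi_cocycle \<beta> (x + 1) = psi_cocycle \<beta> x" for x
      using psi_periodic[of "x + offset \<beta> j" for j] by (simp add: vec_eq_iff psi_cocycle_nth algebra_simps)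
    show "(\<lambda>n. real (q n) * \<alpha> - of_int (p n)) \<longlonglongrightarrow> 0"
    proof (rule Lim_null_comparison)
      show "(\<lambda>n. inverse (real (Suc n))) \<longlonglongrightarrow> 0"
        by (rule LIMSEQ_inverse_real_of_nat)
      show "\<forall>\<^sub>F n in sequentially. norm (real (q n) * \<alpha> - of_int (p n)) \<le> inverse (real (Suc n))"
      proof (intro always_eventually allI)
        fix n
        have "1 / real (q n) \<le> 1 / real (Suc n)"
          using q[of n] by (intro divide_left_mono) auto
        then show "norm (real (q n) * \<alpha> - of_int (p n)) \<le> inverse (real (Suc n))"
          using close[of n] by (simp add: inverse_eq_divide)
      qed
    qed
    show "norm (\<Sum>i<q n. psi_cocycle \<beta> (x + real i * \<alpha>)) \<le> ?m * 4" for n x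
    proof -
      have "norm (\<Sum>i<q n. psi_cocycle \<beta> (x + real i * \<alpha>))
          \<le> (\<Sum>j\<in>UNIV. \<bar>(\<Sum>i<q n. psi_cocycle \<beta> (x + real i * \<alpha>)) $ j\<bar>)"
        by (rule norm_le_l1_cart)
      also have "\<dots> \<le> (\<Sum>j\<in>(UNIV :: 'd option set). 4)"
        unfolding comp by (intro sum_mono abs_sum_psi_le[OF q0 cop close])
      finally show ?thesis
        by simp
    qed
  qed (use \<alpha> countable_discontinuities_psi_cocycle in auto)
  have hit: "\<exists>c>0. \<forall>N. \<exists>n\<ge>N. c \<le> measure lborel {x\<in>{0..<1}. \<exists>k\<in>integer_lattice. norm (S n x - v - k) < e}"
    if e: "e > 0" for v e
  proof -
    \<comment> \<open>Each of the \<open>?m\<close> coordinates carries an error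
      \<open>2 * \<eta>\<close>, one part from \<open>x\<close> and one from \<beta>; the cap 1/2 is
      required by the measure bound.\<close>
    define \<eta> where "\<eta> = min (1 / 2) (e / (2 * ?m))"
    have m: "?m > 0"
      by simp
    have \<eta>: "0 < \<eta>" "\<eta> \<le> 1 / 2"
      using e by (simp add: \<eta>_def) (simp only: \<eta>_def min.cobounded1)
    have "\<eta> \<le> e / (2 * ?m)"
      unfolding \<eta>_def by (rule min.cobounded2)
    have \<eta>3: "2 * \<eta> * ?m \<le> e"
    proof -
      have "2 * \<eta> * c \<le> e" if "\<eta> \<le> e / (2 * c)" "c > 0" for c
        using that by (simp add: field_simps)
      then show ?thesis
        using m \<open>\<eta> \<le> e / (2 * ?m)\<close> by blast
    qed
    show ?thesis
    proof (intro exI[of _ \<eta>] conjI allI)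
      show "\<eta> > 0" by fact
      fix N
      obtain n where n: "n \<ge> N" "\<And>i. \<exists>z::int. \<bar>real (q n) * \<beta> i - (v $ Some i - v $ None) - of_int z\<bar> < \<eta>"
        using dense[OF \<eta>(1), of N "\<lambda>i. v $ Some i - v $ None"] by blast
      \<comment> \<open>For \<open>None\<close> both the offset and the target difference are 0, so
        the integer 0 works.\<close>
      have off: "\<exists>z::int. \<bar>real (q n) * offset \<beta> j - (v $ j - v $ None) - of_int z\<bar> < \<eta>" for j
        using n(2) \<eta>(1) by (cases j) (auto simp: offset_def intro!: exI[of _ 0])
      define c where "c = (\<Sum>i<q n. real i * \<alpha> - 1 / 2)"
      let ?G = "{x\<in>{0..<1}. \<exists>k\<in>integer_lattice. norm (S n x - v - k) < e}"
      let ?G' = "{x\<in>{0..<1}. \<exists>z::int. \<bar>real (q n) * x + (c - v $ None) - of_int z\<bar> < \<eta>}"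
      have sub: "?G' \<subseteq> ?G"
      proof
        fix x assume "x \<in> ?G'"
        then obtain z0 :: int where x: "x \<in> {0..<1}" "\<bar>real (q n) * x + (c - v $ None) - of_int z0\<bar> < \<eta>"
          by blast
        have "\<exists>k::int. \<bar>S n x $ j - v $ j - of_int k\<bar> < 2 * \<eta>" for j
        proof -
          obtain z :: int where z: "\<bar>real (q n) * offset \<beta> j - (v $ j - v $ None) - of_int z\<bar> < \<eta>"
            using off by blast
          obtain k :: int where k: "S n x $ j = real (q n) * (x + offset \<beta> j) + c + of_int k"
            using sum_psi_mod_1[where x = "x + offset \<beta> j" and \<alpha> = \<alpha> and q = "q n"]
            unfolding S_def birkhoff_def comp c_def by (elim exE)
          \<comment> \<open>The first bracket is common to all coordinates and controlled by
            \<open>x\<close>, the second by the choice of \<open>n\<close>; \<open>v $ None\<close>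
            cancels between them.\<close>
          have "S n x $ j - v $ j - of_int (k + z0 + z) = (real (q n) * x + (c - v $ None) - of_int z0)
              + (real (q n) * offset \<beta> j - (v $ j - v $ None) - of_int z)"
            by (simp add: k algebra_simps)
          then have "\<bar>S n x $ j - v $ j - of_int (k + z0 + z)\<bar> < 2 * \<eta>"
            using z x(2) by linarith
          then show ?thesis ..
        qed
        then obtain k where k: "\<And>j. \<bar>S n x $ j - v $ j - of_int (k j)\<bar> < 2 * \<eta>"
          by metis
        have "norm (S n x - v - (\<chi> j. of_int (k j))) \<le> (\<Sum>j\<in>UNIV. \<bar>(S n x - v - (\<chi> j. of_int (k j))) $ j\<bar>)"
          by (rule norm_le_l1_cart)
        also have "\<dots> < (\<Sum>j\<in>(UNIV :: 'd option set). 2 * \<eta>)"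
          using k by (intro sum_strict_mono) auto
        also have "\<dots> \<le> e"
          using \<eta>3 by (simp add: mult.commute)
        finally have "norm (S n x - v - (\<chi> j. of_int (k j))) < e" .
        moreover have "(\<chi> j. of_int (k j)) \<in> integer_lattice"
          by (simp add: integer_lattice_def)
        ultimately show "x \<in> ?G"
          using x(1) by blast
      qed
      have G: "?G \<in> sets borel"
      proof -
        have "open (\<Union>k\<in>integer_lattice. {u. norm (u - v - k) < e})"
          by (intro open_UN ballI open_Collect_less continuous_intros)
        then have "(\<Union>k\<in>integer_lattice. {u. norm (u - v - k) < e}) \<in> sets borel"
          by simp
        from measurable_sets_borel[OF S_measurable this, of n]
        have "S n -` (\<Union>k\<in>integer_lattice. {u. norm (u - v - k) < e}) \<inter> {0..<1} \<in> sets borel"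
          by auto
        also have "S n -` (\<Union>k\<in>integer_lattice. {u. norm (u - v - k) < e}) \<inter> {0..<1} = ?G"
          by auto
        finally show ?thesis .
      qed
      have "\<eta> \<le> measure lborel ?G'"
        by (rule measure_affine_near_Ints[OF q0 \<eta>(1,2)])
      also have "\<dots> \<le> measure lborel ?G"
      proof (rule measure_mono_fmeasurable[OF sub])
        show "?G' \<in> sets lborel"
          by measurable
        have "emeasure lborel ?G \<le> emeasure lborel {0..<1::real}"
          by (intro emeasure_mono) auto
        then show "?G \<in> fmeasurable lborel"
          using G by (auto simp: fmeasurable_def intro: order_le_less_trans)
      qed
      finally show "\<exists>n\<ge>N. \<eta> \<le> measure lborel {x\<in>{0..<1}. \<exists>k\<in>integer_lattice. norm (S n x - v - k) < e}"
        using n(1) by blast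
    qed
  qed
  let ?M = "circle_measure \<Otimes>\<^sub>M (lborel :: (real ^ 'd option) measure)"
  have "emeasure ?M A = 0 \<or> emeasure ?M (space ?M - A) = 0"
    if A: "A \<in> sets ?M" and inv: "skew_product (circle_rotation \<alpha>) (psi_cocycle \<beta>) -` A \<inter> space ?M = A" for A
  proof -
    have "sets ?M = sets (circle_measure \<Otimes>\<^sub>M borel)"
      by (rule sets_pair_measure_cong) auto
    then have A': "A \<in> sets (circle_measure \<Otimes>\<^sub>M borel)"
      using A by simp
    have "(circle_rotation \<alpha> y, s + psi_cocycle \<beta> y) \<in> A \<longleftrightarrow> (y, s) \<in> A" if "y \<in> {0..<1}" for y s
    proof -
      have "(y, s) \<in> space ?M"
        using that by (simp add: space_pair_measure)
      then have "(y, s) \<in> A \<longleftrightarrow> skew_product (circle_rotation \<alpha>) (psi_cocycle \<beta>) (y, s) \<in> A"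
        using inv by blast
      then show ?thesis
        by (simp add: skew_product_def)
    qed
    from skew_product_null_or_conull[OF A' this closed_integer_lattice finite_integer_lattice_cball hit]
    show ?thesis
    proof
      assume "AE z in ?M. z \<in> A"
      then have "emeasure ?M {z \<in> space ?M. z \<notin> A} = 0"
        by (intro emeasure_eq_0_AE) simp
      then show ?thesis
        by (simp add: set_diff_eq)
    next
      assume "AE z in ?M. z \<notin> A"
      then have "emeasure ?M {z \<in> space ?M. z \<in> A} = 0"
        by (intro emeasure_eq_0_AE) simp
      moreover have "{z \<in> space ?M. z \<in> A} = A"
        using sets.sets_into_space[OF A] by blast
      ultimately show ?thesis
        by simp
    qed
  qed
  then have "\<forall>A\<in>sets ?M. skew_product (circle_rotation \<alpha>) (psi_cocycle \<beta>) -` A \<inter> space ?M = A \<longrightarrow>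
      emeasure ?M A = 0 \<or> emeasure ?M (space ?M - A) = 0"
    by blast
  then show ?thesis
    unfolding ergodic_cocycle_def ergodic_map_def
    by (intro conjI skew_product_rotation_measure_preserving psi_cocycle_measurable
        measurable_circle_if_borel[OF psi_cocycle_measurable])
qed

section \<open>Residuality\<close>

lemma compact_space_circle_topology: "compact_space circle_topology"
proof -
  have "compactin circle_topology (frac ` {0..1})"
    by (rule image_compactin[of euclidean]) (auto intro: quotient_imp_continuous_map quotient_map_frac)
  moreover have "frac ` {0..1} = {0..<1 :: real}"
  proof
    show "frac ` {0..1} \<subseteq> {0..<1 :: real}"
      by (auto simp: frac_lt_1)
    show "{0..<1 :: real} \<subseteq> frac ` {0..1}"
      by (auto intro!: image_eqI[where x = x for x] simp: frac_eq)
  qed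
  ultimately show ?thesis
    by (simp add: compact_space_def)
qed

text \<open>The exponential parametrization of the unit circle has period 1, hence is continuous on
  the quotient, and it separates the points of [0,1).\<close>

lemma Hausdorff_space_circle_topology: "Hausdorff_space circle_topology"
proof (rule Hausdorff_space_injective_preimage)
  let ?f = "\<lambda>x. cis (2 * pi * x)"
  have per: "?f (frac x) = ?f x" for x
    by (rule periodic_frac(2)[of ?f]) (simp add: distrib_left flip: cis_mult)
  show "continuous_map circle_topology euclidean ?f"
  proof (rule continuous_compose_quotient_map[OF quotient_map_frac])
    show "continuous_map euclidean euclidean (?f \<circ> frac)"
      unfolding o_def per by (auto intro!: continuous_intros)
  qed
  show "inj_on ?f (topspace circle_topology)"
  proof (rule inj_onI)
    fix x y assume xy: "x \<in> topspace circle_topology" "y \<in> topspace circle_topology" and "?f x = ?f y"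
    then have "cis (2 * pi * x - 2 * pi * y) = 1"
      by (simp flip: cis_divide)
    then obtain n :: int where "2 * pi * x - 2 * pi * y = of_int n * 2 * pi"
      by (auto simp: complex_eq_iff cos_one_2pi_int)
    then have "2 * pi * (x - y) = 2 * pi * of_int n"
      by (simp add: algebra_simps)
    then have "x - y = of_int n"
      by simp
    moreover have "\<bar>x - y\<bar> < 1"
      using xy by auto
    ultimately have "\<bar>of_int n :: real\<bar> < 1"
      by simp
    then have "n = 0"
      by linarith
    with \<open>x - y = of_int n\<close> show "x = y"
      by simp
  qed
qed simp

section \<open>Density of the approximation conditions\<close>

definition multiple_near :: "nat \<Rightarrow> real \<Rightarrow> real \<Rightarrow> real set" where
  "multiple_near q t e = {b \<in> {0..<1}. \<exists>z::int. \<bar>real q * b - t - of_int z\<bar> < e}"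

lemma multiple_near_frac: "frac x \<in> multiple_near q t e \<longleftrightarrow> (\<exists>z::int. \<bar>real q * x - t - of_int z\<bar> < e)"
proof -
  have eq: "real q * frac x - t - of_int z = real q * x - t - of_int (z + int q * \<lfloor>x\<rfloor>)" for z
    by (simp add: frac_def algebra_simps)
  have "(\<exists>z::int. \<bar>real q * frac x - t - of_int z\<bar> < e) \<longleftrightarrow> (\<exists>z::int. \<bar>real q * x - t - of_int z\<bar> < e)"
    unfolding eq by (metis add.commute diff_add_cancel)
  then show ?thesis
    by (simp add: multiple_near_def frac_lt_1)
qed

lemma openin_multiple_near: "openin circle_topology (multiple_near q t e)"
proof -
  have "frac -` multiple_near q t e = (\<Union>z::int. {x. \<bar>real q * x - t - of_int z\<bar> < e})"
    by (auto simp: multiple_near_frac)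
  moreover have "open \<dots>"
    by (intro open_UN ballI open_Collect_less continuous_intros)
  moreover have "multiple_near q t e \<subseteq> {0..<1}"
    by (auto simp: multiple_near_def)
  ultimately show ?thesis
    by (simp add: openin_circle_topology)
qed

text \<open>The solutions of \<open>q x = t\<close> modulo 1 have spacing \<open>1 / q\<close>. Once
  this is below the smallest radius among the finitely many coordinates, every \<open>U i\<close>
  contains one, so a single \<open>n\<close> serves all coordinates.\<close>

lemma multiple_near_dense:
  fixes U :: "'d::finite \<Rightarrow> real set"
  assumes U: "\<And>i. openin circle_topology (U i)" "\<And>i. b i \<in> U i" and e: "e > 0" and q: "\<And>n. q n > (n::nat)"
  shows "\<exists>n\<ge>N. \<forall>i. U i \<inter> multiple_near (q n) (t i) e \<noteq> {}"
proof -
  have "\<exists>d>0. \<forall>x. dist x (b i) < d \<longrightarrow> frac x \<in> U i" for i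
  proof -
    have "open (frac -` U i)" "U i \<subseteq> {0..<1}"
      using U(1)[of i] by (simp_all add: openin_circle_topology)
    moreover have "b i \<in> frac -` U i"
      using U(2)[of i] calculation(2) by (auto simp: frac_eq_id)
    ultimately show ?thesis
      unfolding open_dist by blast
  qed
  then obtain d where d: "\<And>i. d i > 0" "\<And>i x. dist x (b i) < d i \<Longrightarrow> frac x \<in> U i"
    by metis
  let ?d = "Min (range d)"
  have d0: "?d > 0"
    using d(1) by (subst Min_gr_iff) auto
  then obtain m :: nat where m: "1 / ?d < real m"
    using reals_Archimedean2 by blast
  define n where "n = max N m"
  have "1 / ?d < real (q n)"
    using m q[of n] by (simp add: n_def)
  moreover have q0: "real (q n) > 0"
    using q[of n] by simp
  moreover have "1 / r < c" if "1 / c < r" "r > 0" "c > 0" for r c :: real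
    using that by (simp add: field_simps)
  ultimately have qd: "1 / real (q n) < ?d"
    using d0 by blast
  have "U i \<inter> multiple_near (q n) (t i) e \<noteq> {}" for i
  proof -
    \<comment> \<open>With this integer part, \<open>x\<close> is the largest solution of
      \<open>q x = t\<close> modulo 1 that does not exceed \<open>b i\<close>.\<close>
    define z where "z = \<lfloor>real (q n) * b i - t i\<rfloor>"
    define x where "x = (t i + of_int z) / real (q n)"
    have qx: "real (q n) * x - t i - of_int z = 0"
      using q0 by (simp add: x_def)
    have "real (q n) * \<bar>b i - x\<bar> = \<bar>real (q n) * (b i - x)\<bar>"
      by (simp add: abs_mult)
    also have "\<dots> = \<bar>(real (q n) * b i - t i) - of_int z\<bar>"
      using qx by (simp add: algebra_simps)
    also have "\<dots> \<le> 1"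
      unfolding z_def by linarith
    finally have "\<bar>b i - x\<bar> \<le> 1 / real (q n)"
      using q0 by (simp add: field_simps)
    also have "\<dots> < d i"
      by (rule order_less_le_trans[OF qd Min_le]) auto
    finally have "frac x \<in> U i"
      by (intro d(2)) (simp add: dist_real_def abs_minus_commute)
    moreover have "frac x \<in> multiple_near (q n) (t i) e"
      unfolding multiple_near_frac using qx e by (intro exI[of _ z]) simp
    ultimately show ?thesis
      by blast
  qed
  moreover have "n \<ge> N"
    by (simp add: n_def)
  ultimately show ?thesis
    by blast
qed

text \<open>Rational targets and tolerances \<open>1 / (k + 1)\<close> reduce the condition to
  countably many open sets. Each is a union over \<open>n \<ge> N\<close> of products of open sets,
  with the same \<open>n\<close> in all factors, and is dense by the spacing argument.\<close>

lemma residual_dense_multiples: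
  fixes q :: "nat \<Rightarrow> nat"
  assumes q: "\<And>n. q n > n"
  shows "residual_in torus_topology {\<beta> :: 'd::finite \<Rightarrow> real. (\<forall>i. \<beta> i \<in> {0..<1}) \<and>
    (\<forall>\<theta> e N. e > 0 \<longrightarrow> (\<exists>n\<ge>N. \<forall>i. \<exists>z::int. \<bar>real (q n) * \<beta> i - \<theta> i - of_int z\<bar> < e))}"
    (is "residual_in ?X ?S")
proof -
  define V where "V = (\<lambda>(\<theta> :: 'd \<Rightarrow> rat, k :: nat, N).
    \<Union>n\<in>{N..}. (Pi\<^sub>E UNIV (\<lambda>i. multiple_near (q n) (of_rat (\<theta> i)) (1 / real (Suc k)))) :: ('d \<Rightarrow> real) set)"
  have top: "topspace ?X = {\<beta>. \<forall>i. \<beta> i \<in> {0..<1}}"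
    by (auto simp: PiE_UNIV_domain)
  have V_open: "openin ?X (V t)" for t
    unfolding V_def case_prod_beta by (intro openin_clauses(3) ballI) (auto simp: openin_PiE openin_multiple_near)
  have V_dense: "?X closure_of V t = topspace ?X" for t
    unfolding dense_intersects_open
  proof (intro allI impI, elim conjE)
    fix T assume T: "openin ?X T" "T \<noteq> {}"
    obtain \<theta> k N where t: "t = (\<theta>, k, N)"
      by (cases t)
    obtain b where "b \<in> T"
      using T(2) by blast
    then obtain U where "\<forall>i\<in>UNIV. openin circle_topology (U i)" "b \<in> Pi\<^sub>E UNIV U" and UT: "Pi\<^sub>E UNIV U \<subseteq> T"
      using bspec[OF openin_product_topology_alt[THEN iffD1, OF T(1)]] by blast
    then have U: "\<And>i. openin circle_topology (U i)" "\<And>i. b i \<in> U i"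
      by auto
    obtain n where n: "n \<ge> N" "\<And>i. U i \<inter> multiple_near (q n) (of_rat (\<theta> i)) (1 / real (Suc k)) \<noteq> {}"
      using multiple_near_dense[where U = U and b = b and e = "1 / real (Suc k)" and q = q and N = N and t = "\<lambda>i. of_rat (\<theta> i)"]
        U(1,2) q by auto
    have "\<exists>g. \<forall>i. g i \<in> U i \<inter> multiple_near (q n) (of_rat (\<theta> i)) (1 / real (Suc k))"
      by (rule choice) (use n(2) in blast)
    then obtain g where g: "\<And>i. g i \<in> U i \<inter> multiple_near (q n) (of_rat (\<theta> i)) (1 / real (Suc k))"
      by blast
    then have "g \<in> V t \<inter> T"
      using UT n(1) g by (auto simp: V_def t PiE_UNIV_domain)
    then show "V t \<inter> T \<noteq> {}"
      by blast
  qed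
  have "compact_space ?X" "Hausdorff_space ?X"
    by (simp_all add: compact_space_product_topology compact_space_circle_topology
        Hausdorff_space_product_topology Hausdorff_space_circle_topology)
  \<comment> \<open>Baire's theorem applies to locally compact regular spaces; compact Hausdorff
    gives both.\<close>
  then have "?X closure_of \<Inter>(range V) = topspace ?X"
    using V_open V_dense compact_imp_locally_compact_space compact_Hausdorff_imp_regular_space
    by (intro Baire_category) (simp_all only: countableI_type countable_image image_iff, blast+)
  moreover have "gdelta_in ?X (\<Inter>(range V))"
    using V_open by (intro gdelta_in_Inter) (auto intro: open_imp_gdelta_in)
  moreover have "\<Inter>(range V) \<subseteq> ?S"
  proof
    fix \<beta> assume "\<beta> \<in> \<Inter>(range V)"
    then have \<beta>: "\<exists>n\<ge>N. \<forall>i. \<beta> i \<in> multiple_near (q n) (of_rat (\<theta> i)) (1 / real (Suc k))" for \<theta> k N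
      by (force simp: V_def PiE_UNIV_domain)
    have "\<exists>n\<ge>N. \<forall>i. \<exists>z::int. \<bar>real (q n) * \<beta> i - \<theta> i - of_int z\<bar> < e" if e: "e > 0" for \<theta> e N
    proof -
      \<comment> \<open>Half of the tolerance is spent on making the target rational, the other half
        on \<open>1 / (k + 1)\<close>.\<close>
      have "\<exists>r. \<bar>of_rat r - \<theta> i\<bar> < e / 2" for i
      proof -
        obtain r where "\<theta> i < of_rat r" "of_rat r < \<theta> i + e / 2"
          using of_rat_dense[of "\<theta> i" "\<theta> i + e / 2"] e by auto
        then show ?thesis
          by (intro exI[of _ r]) auto
      qed
      then obtain r where r: "\<And>i. \<bar>of_rat (r i) - \<theta> i\<bar> < e / 2"
        by metis
      obtain k where k: "1 / real (Suc k) < e / 2"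
        using reals_Archimedean[of "e / 2"] e by (auto simp: inverse_eq_divide)
      obtain n where n: "n \<ge> N" "\<And>i. \<beta> i \<in> multiple_near (q n) (of_rat (r i)) (1 / real (Suc k))"
        using \<beta> by blast
      have "\<exists>z::int. \<bar>real (q n) * \<beta> i - \<theta> i - of_int z\<bar> < e" for i
      proof -
        obtain z :: int where "\<bar>real (q n) * \<beta> i - of_rat (r i) - of_int z\<bar> < 1 / real (Suc k)"
          using n(2)[of i] by (auto simp: multiple_near_def)
        then have "\<bar>real (q n) * \<beta> i - \<theta> i - of_int z\<bar> < e"
          using r[of i] k by linarith
        then show ?thesis ..
      qed
      then show ?thesis
        using n(1) by blast
    qed
    moreover have "\<beta> i \<in> {0..<1}" for i
      \<comment> \<open>Any one of the conditions contains membership in [0,1).\<close>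
      using \<beta>[of 0 "\<lambda>_. 0" 0] by (auto simp: multiple_near_def)
    ultimately show "\<beta> \<in> ?S"
      by blast
  qed
  moreover have "?S \<subseteq> topspace ?X"
    unfolding top by blast
  ultimately show ?thesis
    unfolding residual_in_def by blast
qed

text \<open>An irrational number has infinitely many reduced fractions \<open>h / k\<close> within
  \<open>1 / k^2\<close>, and these have arbitrarily large denominators. Choosing one with
  denominator above \<open>n\<close> for each \<open>n\<close> makes \<open>q\<close> unbounded and
  the errors \<open>1 / q n\<close> tend to 0.\<close>

lemma exists_rational_approximations:
  assumes "\<alpha> \<notin> \<rat>"
  obtains q :: "nat \<Rightarrow> nat" and p :: "nat \<Rightarrow> int" where "\<And>n. q n > n" "\<And>n. coprime (p n) (int (q n))"
    "\<And>n. \<bar>real (q n) * \<alpha> - of_int (p n)\<bar> < 1 / real (q n)"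
proof -
  have inf: "infinite (approx_set \<alpha>)"
    using assms rational_iff_finite_approx_set by blast
  have "\<exists>q p. q > n \<and> coprime p (int q) \<and> \<bar>real q * \<alpha> - of_int p\<bar> < 1 / real q" for n
  proof -
    obtain h k where hk: "(h, k) \<in> approx_set \<alpha>" "k > int n"
      using infinite_approx_set[OF inf] by blast
    define q where "q = nat k"
    have k: "k = int q" and q: "q > n"
      using hk(2) by (auto simp: q_def)
    have "coprime h (int q)" and a: "\<bar>\<alpha> - of_int h / real q\<bar> < 1 / (real q)\<^sup>2"
      using hk(1) by (auto simp: approx_set_def k)
    moreover have "\<bar>real q * \<alpha> - of_int h\<bar> < 1 / real q"
    proof -
      have "\<bar>real q * \<alpha> - of_int h\<bar> = real q * \<bar>\<alpha> - of_int h / real q\<bar>"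
        using q by (simp add: abs_mult[symmetric] field_simps flip: abs_mult_pos)
      also have "\<dots> < real q * (1 / (real q)\<^sup>2)"
        using a q by (intro mult_strict_left_mono) auto
      also have "\<dots> = 1 / real q"
        using q by (simp add: power2_eq_square)
      finally show ?thesis .
    qed
    ultimately show ?thesis
      using q by blast
  qed
  then show thesis
    using that by metis
qed

theorem proposition4p4:
  fixes \<alpha> :: real
  assumes "0 < \<alpha>" and "\<alpha> < 1" and "\<alpha> \<notin> \<rat>"
  shows "residual_in torus_topology
    {\<beta> :: 'd::finite \<Rightarrow> real. (\<forall>i. \<beta> i \<in> {0..<1}) \<and>
       ergodic_cocycle circle_measure (circle_rotation \<alpha>) (psi_cocycle \<beta>)}"
proof -
  obtain q :: "nat \<Rightarrow> nat" and p :: "nat \<Rightarrow> int" where q: "\<And>n. q n > n" "\<And>n. coprime (p n) (int (q n))"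
    "\<And>n. \<bar>real (q n) * \<alpha> - of_int (p n)\<bar> < 1 / real (q n)"
    using exists_rational_approximations[OF assms(3)] by blast
  let ?S = "{\<beta> :: 'd \<Rightarrow> real. (\<forall>i. \<beta> i \<in> {0..<1}) \<and>
    (\<forall>\<theta> e N. e > 0 \<longrightarrow> (\<exists>n\<ge>N. \<forall>i. \<exists>z::int. \<bar>real (q n) * \<beta> i - \<theta> i - of_int z\<bar> < e))}"
  let ?E = "{\<beta> :: 'd \<Rightarrow> real. (\<forall>i. \<beta> i \<in> {0..<1}) \<and>
    ergodic_cocycle circle_measure (circle_rotation \<alpha>) (psi_cocycle \<beta>)}"
  have "?S \<subseteq> ?E"
    using psi_cocycle_ergodic[where q = q and p = p, OF assms(3) q] by blast
  moreover obtain G where G: "gdelta_in torus_topology G" "torus_topology closure_of G = topspace torus_topology" "G \<subseteq> ?S"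
    using residual_dense_multiples[where q = q and 'd = 'd, OF q(1)] unfolding residual_in_def by (elim conjE exE)
  moreover have "?E \<subseteq> topspace torus_topology"
    by (auto simp: PiE_UNIV_domain)
  ultimately have "?E \<subseteq> topspace torus_topology" "G \<subseteq> ?E"
    by (simp_all only: subset_trans[OF G(3)])
  with G(1,2) show ?thesis
    unfolding residual_in_def by (intro conjI exI[of _ G])
qed

end
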